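(* Let $(F,G):\mathcal{A}\to\mathcal{B}$ be an adjoint pair ($F$ left adjoint to $G$) between bicomplete abelian categories and let $(\varphi,\psi):Pr(\mathcal{A})\to Pr(\mathcal{B})$ be the induced Galois connection. If $h:N\to M$ is any morphism in $\mathcal{A}$, then $\varphi(\alpha_h)=\alpha_{F(h)}$.
   Context: Bicomplete means complete and cocomplete; Hom-classes are sets. A preradical of an abelian category $\mathcal{A}$ is a subobject of the identity functor $1_{\mathcal{A}}$ in the (possibly extended) abelian category $\mathrm{Fun}(\mathcal{A},\mathcal{A})$, i.e. the equivalence class of a monomorphic natural transformation $\tau:T\hookrightarrow 1_{\mathcal{A}}$, two such being equivalent if each factors through the other. $Pr(\mathcal{A})$ is the collection of preradicals, ordered by $\tau\leq\sigma$ iff $\tau$ factors through $\sigma$. With unit $\eta:1_{\mathcal{A}}\to GF$ and counit $\varepsilon:FG\to1_{\mathcal{B}}$, the induced Galois connection is given by $\varphi(\tau)=\mathrm{Im}(\varepsilon\circ F\tau G:FTG\to 1_{\mathcal{B}})$ for $\tau:T\hookrightarrow1_{\mathcal{A}}$, and $\psi(\sigma)=\mathrm{Ker}(\pi_\sigma\circ\eta)$ for $\sigma:S\hookrightarrow 1_{\mathcal{B}}$, where $\pi_\sigma:GF\to\mathrm{Ckr}(G\sigma F)$ is a cokernel of $G\sigma F:GSF\to GF$. Alpha preradicals: for objects $N,M$ of a bicomplete abelian category $\mathcal{A}$, $\mathbb{A}_M^N:\mathcal{A}\to\mathcal{A}$ is the functor with $\mathbb{A}_M^N(L)=N^{(\mathrm{Hom}_{\mathcal{A}}(M,L))}$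 (coproduct of copies of $N$ indexed by $\mathrm{Hom}_{\mathcal{A}}(M,L)$, with canonical inclusions $i_f$), and, for $\lambda:L\to L'$, $\mathbb{A}_M^N(\lambda)\circ i_f=i'_{\lambda\circ f}$. For a morphism $h:N\to M$, $\mathfrak{a}_h:\mathbb{A}_M^N\to1_{\mathcal{A}}$ is the natural transformation determined by $[\mathfrak{a}_h]_L\circ i_f=f\circ h$ for all $L$ and all $f\in\mathrm{Hom}_{\mathcal{A}}(M,L)$. The alpha preradical associated to $h$ is $\alpha_h:=\mathrm{Im}(\mathfrak{a}_h)$. *)

theory Defs
  imports Main "HOL-Library.FuncSet" "HOL-Library.Equipollence"
begin

section \<open>Categories\<close>

record ('o, 'm) cat =
  Obj :: "'o set"
  Arr :: "'m set"
  Dom :: "'m \<Rightarrow> 'o"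
  Cod :: "'m \<Rightarrow> 'o"
  Idt :: "'o \<Rightarrow> 'm"
  Comp :: "'m \<Rightarrow> 'm \<Rightarrow> 'm" (infixl "\<cdot>\<index>" 70)

definition Hom :: "('o, 'm) cat \<Rightarrow> 'o \<Rightarrow> 'o \<Rightarrow> 'm set" where
  "Hom C X Y = {f \<in> Arr C. Dom C f = X \<and> Cod C f = Y}"

locale category =
  fixes C :: "('o, 'm) cat" (structure)
  assumes Dom_Obj: "f \<in> Arr C \<Longrightarrow> Dom C f \<in> Obj C"
    and Cod_Obj: "f \<in> Arr C \<Longrightarrow> Cod C f \<in> Obj C"
    and Idt_Hom: "X \<in> Obj C \<Longrightarrow> Idt C X \<in> Hom C X X"
    and Comp_Hom: "f \<in> Hom C X Y \<Longrightarrow> g \<in> Hom C Y Z \<Longrightarrow> g \<cdot> f \<in> Hom C X Z"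
    and Comp_Idt: "f \<in> Hom C X Y \<Longrightarrow> f \<cdot> Idt C X = f"
    and Idt_Comp: "f \<in> Hom C X Y \<Longrightarrow> Idt C Y \<cdot> f = f"
    and Comp_assoc: "f \<in> Hom C W X \<Longrightarrow> g \<in> Hom C X Y \<Longrightarrow> k \<in> Hom C Y Z \<Longrightarrow>
                     (k \<cdot> g) \<cdot> f = k \<cdot> (g \<cdot> f)"

definition monic :: "('o, 'm) cat \<Rightarrow> 'm \<Rightarrow> bool" where
  "monic C m \<longleftrightarrow> m \<in> Arr C \<and>
     (\<forall>X. \<forall>u \<in> Hom C X (Dom C m). \<forall>v \<in> Hom C X (Dom C m).
        m \<cdot>\<^bsub>C\<^esub> u = m \<cdot>\<^bsub>C\<^esub> v \<longrightarrow> u = v)"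

definition epic :: "('o, 'm) cat \<Rightarrow> 'm \<Rightarrow> bool" where
  "epic C e \<longleftrightarrow> e \<in> Arr C \<and>
     (\<forall>Y. \<forall>u \<in> Hom C (Cod C e) Y. \<forall>v \<in> Hom C (Cod C e) Y.
        u \<cdot>\<^bsub>C\<^esub> e = v \<cdot>\<^bsub>C\<^esub> e \<longrightarrow> u = v)"

definition zero_object :: "('o, 'm) cat \<Rightarrow> 'o \<Rightarrow> bool" where
  "zero_object C Z \<longleftrightarrow> Z \<in> Obj C \<and>
     (\<forall>X \<in> Obj C. (\<exists>!f. f \<in> Hom C X Z) \<and> (\<exists>!f. f \<in> Hom C Z X))"

definition zero_arrow :: "('o, 'm) cat \<Rightarrow> 'm \<Rightarrow> bool" where
  "zero_arrow C f \<longleftrightarrow> f \<in> Arr C \<and>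
     (\<exists>Z. zero_object C Z \<and>
        (\<exists>u \<in> Hom C (Dom C f) Z. \<exists>v \<in> Hom C Z (Cod C f). f = v \<cdot>\<^bsub>C\<^esub> u))"

definition is_kernel :: "('o, 'm) cat \<Rightarrow> 'm \<Rightarrow> 'm \<Rightarrow> bool" where
  "is_kernel C f k \<longleftrightarrow> f \<in> Arr C \<and> k \<in> Arr C \<and> Cod C k = Dom C f \<and>
     zero_arrow C (f \<cdot>\<^bsub>C\<^esub> k) \<and>
     (\<forall>X. \<forall>g \<in> Hom C X (Dom C f). zero_arrow C (f \<cdot>\<^bsub>C\<^esub> g) \<longrightarrow>
        (\<exists>!u. u \<in> Hom C X (Dom C k) \<and> k \<cdot>\<^bsub>C\<^esub> u = g))"

definition is_cokernel :: "('o, 'm) cat \<Rightarrow> 'm \<Rightarrow> 'm \<Rightarrow> bool" where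
  "is_cokernel C f q \<longleftrightarrow> f \<in> Arr C \<and> q \<in> Arr C \<and> Dom C q = Cod C f \<and>
     zero_arrow C (q \<cdot>\<^bsub>C\<^esub> f) \<and>
     (\<forall>Y. \<forall>g \<in> Hom C (Cod C f) Y. zero_arrow C (g \<cdot>\<^bsub>C\<^esub> f) \<longrightarrow>
        (\<exists>!u. u \<in> Hom C (Cod C q) Y \<and> u \<cdot>\<^bsub>C\<^esub> q = g))"

definition is_product ::
  "('o, 'm) cat \<Rightarrow> 'i set \<Rightarrow> ('i \<Rightarrow> 'o) \<Rightarrow> 'o \<Rightarrow> ('i \<Rightarrow> 'm) \<Rightarrow> bool" where
  "is_product C I X P p \<longleftrightarrow> P \<in> Obj C \<and> (\<forall>i \<in> I. p i \<in> Hom C P (X i)) \<and>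
     (\<forall>Y \<in> Obj C. \<forall>g. (\<forall>i \<in> I. g i \<in> Hom C Y (X i)) \<longrightarrow>
        (\<exists>!u. u \<in> Hom C Y P \<and> (\<forall>i \<in> I. p i \<cdot>\<^bsub>C\<^esub> u = g i)))"

definition is_coproduct ::
  "('o, 'm) cat \<Rightarrow> 'i set \<Rightarrow> ('i \<Rightarrow> 'o) \<Rightarrow> 'o \<Rightarrow> ('i \<Rightarrow> 'm) \<Rightarrow> bool" where
  "is_coproduct C I X Q q \<longleftrightarrow> Q \<in> Obj C \<and> (\<forall>i \<in> I. q i \<in> Hom C (X i) Q) \<and>
     (\<forall>Y \<in> Obj C. \<forall>g. (\<forall>i \<in> I. g i \<in> Hom C (X i) Y) \<longrightarrow>
        (\<exists>!u. u \<in> Hom C Q Y \<and> (\<forall>i \<in> I. u \<cdot>\<^bsub>C\<^esub> q i = g i)))"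

text \<open>Abelian categories in the sense of Freyd; the additive structure on the Hom-sets is
  uniquely determined by these axioms and need not be part of the data.\<close>

locale abelian_category = category C for C :: "('o, 'm) cat" (structure) +
  assumes ex_zero: "\<exists>Z. zero_object C Z"
    and ex_binary_product: "X \<in> Obj C \<Longrightarrow> Y \<in> Obj C \<Longrightarrow>
          \<exists>P p. is_product C (UNIV :: bool set) (\<lambda>b. if b then X else Y) P p"
    and ex_binary_coproduct: "X \<in> Obj C \<Longrightarrow> Y \<in> Obj C \<Longrightarrow>
          \<exists>Q q. is_coproduct C (UNIV :: bool set) (\<lambda>b. if b then X else Y) Q q"
    and ex_kernel: "f \<in> Arr C \<Longrightarrow> \<exists>k. is_kernel C f k"
    and ex_cokernel: "f \<in> Arr C \<Longrightarrow> \<exists>q. is_cokernel C f q"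
    and monic_normal: "monic C m \<Longrightarrow> \<exists>f. is_kernel C f m"
    and epic_normal: "epic C e \<Longrightarrow> \<exists>f. is_cokernel C f e"


section \<open>Functors and the functor category\<close>

text \<open>Functors and natural transformations are taken extensional (\<open>undefined\<close> outside the
  objects and arrows of the source category), so that HOL equality is the intended equality.\<close>

record ('o1, 'm1, 'o2, 'm2) fctr =
  omap :: "'o1 \<Rightarrow> 'o2"
  amap :: "'m1 \<Rightarrow> 'm2"

definition is_functor ::
  "('o1, 'm1) cat \<Rightarrow> ('o2, 'm2) cat \<Rightarrow> ('o1, 'm1, 'o2, 'm2) fctr \<Rightarrow> bool" where
  "is_functor C D F \<longleftrightarrow>
     omap F \<in> Obj C \<rightarrow>\<^sub>E Obj D \<and> amap F \<in> Arr C \<rightarrow>\<^sub>E Arr D \<and>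
     (\<forall>f \<in> Arr C. amap F f \<in> Hom D (omap F (Dom C f)) (omap F (Cod C f))) \<and>
     (\<forall>X \<in> Obj C. amap F (Idt C X) = Idt D (omap F X)) \<and>
     (\<forall>f \<in> Arr C. \<forall>g \<in> Arr C. Cod C f = Dom C g \<longrightarrow>
        amap F (g \<cdot>\<^bsub>C\<^esub> f) = amap F g \<cdot>\<^bsub>D\<^esub> amap F f)"

definition id_fctr :: "('o, 'm) cat \<Rightarrow> ('o, 'm, 'o, 'm) fctr" where
  "id_fctr C = \<lparr>omap = (\<lambda>X \<in> Obj C. X), amap = (\<lambda>f \<in> Arr C. f)\<rparr>"

text \<open>\<open>comp_fctr C G F\<close> is the composite \<open>G F\<close>, where \<open>C\<close> is the source of \<open>F\<close>.\<close>

definition comp_fctr ::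
  "('o1, 'm1) cat \<Rightarrow> ('o2, 'm2, 'o3, 'm3) fctr \<Rightarrow> ('o1, 'm1, 'o2, 'm2) fctr \<Rightarrow>
   ('o1, 'm1, 'o3, 'm3) fctr" where
  "comp_fctr C G F =
     \<lparr>omap = compose (Obj C) (omap G) (omap F), amap = compose (Arr C) (amap G) (amap F)\<rparr>"

record ('o1, 'm1, 'o2, 'm2) nattr =
  src :: "('o1, 'm1, 'o2, 'm2) fctr"
  tgt :: "('o1, 'm1, 'o2, 'm2) fctr"
  component :: "'o1 \<Rightarrow> 'm2"

definition is_nattr ::
  "('o1, 'm1) cat \<Rightarrow> ('o2, 'm2) cat \<Rightarrow> ('o1, 'm1, 'o2, 'm2) nattr \<Rightarrow> bool" where
  "is_nattr C D t \<longleftrightarrow>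
     is_functor C D (src t) \<and> is_functor C D (tgt t) \<and>
     component t \<in> extensional (Obj C) \<and>
     (\<forall>X \<in> Obj C. component t X \<in> Hom D (omap (src t) X) (omap (tgt t) X)) \<and>
     (\<forall>f \<in> Arr C. component t (Cod C f) \<cdot>\<^bsub>D\<^esub> amap (src t) f
                = amap (tgt t) f \<cdot>\<^bsub>D\<^esub> component t (Dom C f))"

definition Fun ::
  "('o1, 'm1) cat \<Rightarrow> ('o2, 'm2) cat \<Rightarrow>
   (('o1, 'm1, 'o2, 'm2) fctr, ('o1, 'm1, 'o2, 'm2) nattr) cat" where
  "Fun C D =
     \<lparr>Obj = {F. is_functor C D F},
      Arr = {t. is_nattr C D t},
      Dom = src,
      Cod = tgt,
      Idt = (\<lambda>F. \<lparr>src = F, tgt = F, component = (\<lambda>X \<in> Obj C. Idt D (omap F X))\<rparr>),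
      Comp = (\<lambda>s t. \<lparr>src = src t, tgt = tgt s,
                     component = (\<lambda>X \<in> Obj C. component s X \<cdot>\<^bsub>D\<^esub> component t X)\<rparr>)\<rparr>"

text \<open>\<open>whisker C H t K\<close> is the natural transformation \<open>H t K\<close>, where \<open>C\<close> is the source of \<open>K\<close>.\<close>

definition whisker ::
  "('o1, 'm1) cat \<Rightarrow> ('o3, 'm3, 'o4, 'm4) fctr \<Rightarrow> ('o2, 'm2, 'o3, 'm3) nattr \<Rightarrow>
   ('o1, 'm1, 'o2, 'm2) fctr \<Rightarrow> ('o1, 'm1, 'o4, 'm4) nattr" where
  "whisker C H t K =
     \<lparr>src = comp_fctr C H (comp_fctr C (src t) K),
      tgt = comp_fctr C H (comp_fctr C (tgt t) K),
      component = (\<lambda>X \<in> Obj C. amap H (component t (omap K X)))\<rparr>"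

definition adjunction ::
  "('oa, 'ma) cat \<Rightarrow> ('ob, 'mb) cat \<Rightarrow>
   ('oa, 'ma, 'ob, 'mb) fctr \<Rightarrow> ('ob, 'mb, 'oa, 'ma) fctr \<Rightarrow>
   ('oa, 'ma, 'oa, 'ma) nattr \<Rightarrow> ('ob, 'mb, 'ob, 'mb) nattr \<Rightarrow> bool" where
  "adjunction A B F G \<eta> \<epsilon> \<longleftrightarrow>
     is_functor A B F \<and> is_functor B A G \<and>
     \<eta> \<in> Hom (Fun A A) (id_fctr A) (comp_fctr A G F) \<and>
     \<epsilon> \<in> Hom (Fun B B) (comp_fctr B F G) (id_fctr B) \<and>
     (\<forall>X \<in> Obj A. component \<epsilon> (omap F X) \<cdot>\<^bsub>B\<^esub> amap F (component \<eta> X) = Idt B (omap F X)) \<and>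
     (\<forall>Y \<in> Obj B. amap G (component \<epsilon> Y) \<cdot>\<^bsub>A\<^esub> component \<eta> (omap G Y) = Idt A (omap G Y))"


section \<open>Smallness and bicompleteness\<close>

text \<open>Smallness is relative to a set \<open>U\<close>, playing the role of a Grothendieck universe: a set
  (of any type) is small if its cardinality is strictly below that of \<open>U\<close>. When \<open>|U|\<close> is
  inaccessible these are exactly the sets equipollent to elements of the universe of rank
  \<open>|U|\<close>; no such condition on \<open>U\<close> is imposed. Completeness with respect to all
  sets of arrows of \<open>C\<close> would force \<open>C\<close> to be a preorder, hence the need for \<open>U\<close>.\<close>

definition small :: "'u set \<Rightarrow> 'x set \<Rightarrow> bool" where
  "small U X \<longleftrightarrow> X \<prec> U"

definition locally_small :: "'u set \<Rightarrow> ('o, 'm) cat \<Rightarrow> bool" where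
  "locally_small U C \<longleftrightarrow> (\<forall>X \<in> Obj C. \<forall>Y \<in> Obj C. small U (Hom C X Y))"

definition is_cone ::
  "('j, 'k) cat \<Rightarrow> ('o, 'm) cat \<Rightarrow> ('j, 'k, 'o, 'm) fctr \<Rightarrow> 'o \<Rightarrow> ('j \<Rightarrow> 'm) \<Rightarrow> bool" where
  "is_cone J C D X p \<longleftrightarrow> X \<in> Obj C \<and> (\<forall>j \<in> Obj J. p j \<in> Hom C X (omap D j)) \<and>
     (\<forall>a \<in> Arr J. amap D a \<cdot>\<^bsub>C\<^esub> p (Dom J a) = p (Cod J a))"

definition is_cocone ::
  "('j, 'k) cat \<Rightarrow> ('o, 'm) cat \<Rightarrow> ('j, 'k, 'o, 'm) fctr \<Rightarrow> 'o \<Rightarrow> ('j \<Rightarrow> 'm) \<Rightarrow> bool" where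
  "is_cocone J C D X q \<longleftrightarrow> X \<in> Obj C \<and> (\<forall>j \<in> Obj J. q j \<in> Hom C (omap D j) X) \<and>
     (\<forall>a \<in> Arr J. q (Cod J a) \<cdot>\<^bsub>C\<^esub> amap D a = q (Dom J a))"

definition is_limit ::
  "('j, 'k) cat \<Rightarrow> ('o, 'm) cat \<Rightarrow> ('j, 'k, 'o, 'm) fctr \<Rightarrow> 'o \<Rightarrow> ('j \<Rightarrow> 'm) \<Rightarrow> bool" where
  "is_limit J C D X p \<longleftrightarrow> is_cone J C D X p \<and>
     (\<forall>Y r. is_cone J C D Y r \<longrightarrow>
        (\<exists>!u. u \<in> Hom C Y X \<and> (\<forall>j \<in> Obj J. p j \<cdot>\<^bsub>C\<^esub> u = r j)))"

definition is_colimit ::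
  "('j, 'k) cat \<Rightarrow> ('o, 'm) cat \<Rightarrow> ('j, 'k, 'o, 'm) fctr \<Rightarrow> 'o \<Rightarrow> ('j \<Rightarrow> 'm) \<Rightarrow> bool" where
  "is_colimit J C D X q \<longleftrightarrow> is_cocone J C D X q \<and>
     (\<forall>Y r. is_cocone J C D Y r \<longrightarrow>
        (\<exists>!u. u \<in> Hom C X Y \<and> (\<forall>j \<in> Obj J. u \<cdot>\<^bsub>C\<^esub> q j = r j)))"

text \<open>Every small category is isomorphic to one whose objects and arrows are elements of the
  type \<open>'u\<close>, so it suffices to quantify over these as index categories.\<close>

definition bicomplete :: "'u set \<Rightarrow> ('o, 'm) cat \<Rightarrow> bool" where
  "bicomplete U C \<longleftrightarrow>
     (\<forall>(J :: ('u, 'u) cat) D.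
        category J \<and> small U (Obj J) \<and> small U (Arr J) \<and> is_functor J C D \<longrightarrow>
        (\<exists>X p. is_limit J C D X p) \<and> (\<exists>X q. is_colimit J C D X q))"


section \<open>Subobjects and preradicals\<close>

definition factors_through :: "('o, 'm) cat \<Rightarrow> 'm \<Rightarrow> 'm \<Rightarrow> bool" where
  "factors_through C f g \<longleftrightarrow> (\<exists>u \<in> Hom C (Dom C f) (Dom C g). f = g \<cdot>\<^bsub>C\<^esub> u)"

definition subobject_class :: "('o, 'm) cat \<Rightarrow> 'm \<Rightarrow> 'm set" where
  "subobject_class C m =
     {m'. monic C m' \<and> Cod C m' = Cod C m \<and> factors_through C m' m \<and> factors_through C m m'}"

definition subobjects :: "('o, 'm) cat \<Rightarrow> 'o \<Rightarrow> 'm set set" where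
  "subobjects C X = {subobject_class C m | m. monic C m \<and> Cod C m = X}"

text \<open>Kernels are unique up to isomorphism, so in an abelian category the sets below are single
  equivalence classes, i.e. subobjects. The image is the kernel of the cokernel.\<close>

definition kernel_subobject :: "('o, 'm) cat \<Rightarrow> 'm \<Rightarrow> 'm set" where
  "kernel_subobject C f = {k. is_kernel C f k}"

definition image_subobject :: "('o, 'm) cat \<Rightarrow> 'm \<Rightarrow> 'm set" where
  "image_subobject C f = (\<Union>q \<in> {q. is_cokernel C f q}. kernel_subobject C q)"

definition Pr :: "('o, 'm) cat \<Rightarrow> ('o, 'm, 'o, 'm) nattr set set" where
  "Pr C = subobjects (Fun C C) (id_fctr C)"

text \<open>The union over all representatives is the usual way of lifting a function that respects
  the equivalence relation to equivalence classes. Likewise for the choice of cokernel.\<close>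

definition induced_phi ::
  "('oa, 'ma) cat \<Rightarrow> ('ob, 'mb) cat \<Rightarrow>
   ('oa, 'ma, 'ob, 'mb) fctr \<Rightarrow> ('ob, 'mb, 'oa, 'ma) fctr \<Rightarrow> ('ob, 'mb, 'ob, 'mb) nattr \<Rightarrow>
   ('oa, 'ma, 'oa, 'ma) nattr set \<Rightarrow> ('ob, 'mb, 'ob, 'mb) nattr set" where
  "induced_phi A B F G \<epsilon> =
     (\<lambda>P \<in> Pr A. \<Union>\<tau> \<in> P. image_subobject (Fun B B) (\<epsilon> \<cdot>\<^bsub>Fun B B\<^esub> whisker B F \<tau> G))"

definition induced_psi ::
  "('oa, 'ma) cat \<Rightarrow> ('ob, 'mb) cat \<Rightarrow>
   ('oa, 'ma, 'ob, 'mb) fctr \<Rightarrow> ('ob, 'mb, 'oa, 'ma) fctr \<Rightarrow> ('oa, 'ma, 'oa, 'ma) nattr \<Rightarrow>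
   ('ob, 'mb, 'ob, 'mb) nattr set \<Rightarrow> ('oa, 'ma, 'oa, 'ma) nattr set" where
  "induced_psi A B F G \<eta> =
     (\<lambda>S \<in> Pr B. \<Union>\<sigma> \<in> S. \<Union>\<pi> \<in> {\<pi>. is_cokernel (Fun A A) (whisker A G \<sigma> F) \<pi>}.
        kernel_subobject (Fun A A) (\<pi> \<cdot>\<^bsub>Fun A A\<^esub> \<eta>))"

definition induced_galois_connection ::
  "('oa, 'ma) cat \<Rightarrow> ('ob, 'mb) cat \<Rightarrow>
   ('oa, 'ma, 'ob, 'mb) fctr \<Rightarrow> ('ob, 'mb, 'oa, 'ma) fctr \<Rightarrow>
   ('oa, 'ma, 'oa, 'ma) nattr \<Rightarrow> ('ob, 'mb, 'ob, 'mb) nattr \<Rightarrow>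
   (('oa, 'ma, 'oa, 'ma) nattr set \<Rightarrow> ('ob, 'mb, 'ob, 'mb) nattr set) \<times>
   (('ob, 'mb, 'ob, 'mb) nattr set \<Rightarrow> ('oa, 'ma, 'oa, 'ma) nattr set)" where
  "induced_galois_connection A B F G \<eta> \<epsilon> = (induced_phi A B F G \<epsilon>, induced_psi A B F G \<eta>)"


section \<open>Alpha preradicals\<close>

text \<open>A chosen coproduct of copies of \<open>N\<close> indexed by \<open>I\<close>, together with its inclusions.\<close>

definition copower :: "('o, 'm) cat \<Rightarrow> 'o \<Rightarrow> 'i set \<Rightarrow> 'o \<times> ('i \<Rightarrow> 'm)" where
  "copower C N I = (SOME (Q, q). is_coproduct C I (\<lambda>_. N) Q q)"

definition alpha_obj :: "('o, 'm) cat \<Rightarrow> 'o \<Rightarrow> 'o \<Rightarrow> 'o \<Rightarrow> 'o" where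
  "alpha_obj C N M L = fst (copower C N (Hom C M L))"

definition alpha_incl :: "('o, 'm) cat \<Rightarrow> 'o \<Rightarrow> 'o \<Rightarrow> 'o \<Rightarrow> 'm \<Rightarrow> 'm" where
  "alpha_incl C N M L = snd (copower C N (Hom C M L))"

definition alpha_fctr :: "('o, 'm) cat \<Rightarrow> 'o \<Rightarrow> 'o \<Rightarrow> ('o, 'm, 'o, 'm) fctr" where
  "alpha_fctr C N M =
     \<lparr>omap = (\<lambda>L \<in> Obj C. alpha_obj C N M L),
      amap = (\<lambda>l \<in> Arr C.
        THE u. u \<in> Hom C (alpha_obj C N M (Dom C l)) (alpha_obj C N M (Cod C l)) \<and>
          (\<forall>f \<in> Hom C M (Dom C l).
             u \<cdot>\<^bsub>C\<^esub> alpha_incl C N M (Dom C l) f = alpha_incl C N M (Cod C l) (l \<cdot>\<^bsub>C\<^esub> f)))\<rparr>"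

definition alpha_nattr :: "('o, 'm) cat \<Rightarrow> 'm \<Rightarrow> ('o, 'm, 'o, 'm) nattr" where
  "alpha_nattr C h =
     (let N = Dom C h; M = Cod C h in
      \<lparr>src = alpha_fctr C N M,
       tgt = id_fctr C,
       component = (\<lambda>L \<in> Obj C.
         THE u. u \<in> Hom C (alpha_obj C N M L) L \<and>
           (\<forall>f \<in> Hom C M L. u \<cdot>\<^bsub>C\<^esub> alpha_incl C N M L f = f \<cdot>\<^bsub>C\<^esub> h))\<rparr>)"

definition alpha_preradical :: "('o, 'm) cat \<Rightarrow> 'm \<Rightarrow> ('o, 'm, 'o, 'm) nattr set" where
  "alpha_preradical C h = image_subobject (Fun C C) (alpha_nattr C h)"

end

theory Submission imports Defs begin

text \<open>The image of an arrow is determined by the arrows annihilating it from the left. In a functor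
  category zero arrows are detected pointwise. For \<open>s : 1 \<rightarrow> K\<close> and \<open>\<tau> = Im(a_h)\<close>, the component at
  \<open>Y\<close> of \<open>s \<epsilon> F\<tau>G\<close> is the transpose of \<open>G(s_Y) \<tau>_{GY}\<close>, which vanishes iff \<open>G(s_Y) (a_h)_{GY}\<close> does,
  i.e. iff \<open>G(s_Y) f h = 0\<close> for all \<open>f : M \<rightarrow> GY\<close>. Transposing back, this says that
  \<open>s_Y g F(h) = 0\<close> for all \<open>g : FM \<rightarrow> Y\<close>, i.e. that \<open>s\<close> annihilates \<open>a_{F(h)}\<close>.\<close>

section \<open>Zero arrows, kernels and cokernels\<close>

text \<open>The delicate point is the passage from \<tau> to a_h under the single arrow G(s_Y). Such
  an arrow is in general no component of a natural transformation out of the identity of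
  \<open>A\<close>, so the universal property of a cokernel in \<open>Fun A A\<close> cannot be
  applied to it. Hence cokernels in the functor category are built object by object: once G(s_Y)
  annihilates the component of a_h at GY, it factors through the component of the cokernel there,
  and so it annihilates the kernel of the cokernel too. Arrows are never added. A zero arrow is one
  that factors through a zero object, and vanishing is always proved from the uniqueness of arrows
  into and out of zero objects. Subobjects are sets of arrows and \<phi> is a union over
  representatives. The equality of sets therefore rests on three facts: the cokernels of an arrow
  depend on its left annihilators alone, every representative \<tau> is a kernel of the same
  cokernel and gives the same set, and the class \<alpha>_h is inhabited.\<close>

lemma Hom_iff: "f \<in> Hom C X Y \<longleftrightarrow> f \<in> Arr C \<and> Dom C f = X \<and> Cod C f = Y"
  by (simp add: Hom_def)

context category
begin

lemma Arr_Hom: "f \<in> Arr C \<Longrightarrow> f \<in> Hom C (Dom C f) (Cod C f)"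
  by (simp add: Hom_iff)

lemma Hom_Obj: "f \<in> Hom C X Y \<Longrightarrow> X \<in> Obj C" "f \<in> Hom C X Y \<Longrightarrow> Y \<in> Obj C"
  using Dom_Obj Cod_Obj by (auto simp: Hom_iff)

lemma zero_arrowE:
  assumes "zero_arrow C f" "f \<in> Hom C X Y"
  obtains Z u v where "zero_object C Z" "u \<in> Hom C X Z" "v \<in> Hom C Z Y" "f = v \<cdot> u"
  using assms by (auto simp: zero_arrow_def Hom_iff)

lemma zero_arrowI:
  assumes "zero_object C Z" "u \<in> Hom C X Z" "v \<in> Hom C Z Y"
  shows "zero_arrow C (v \<cdot> u)"
proof -
  have "v \<cdot> u \<in> Hom C X Y" using assms Comp_Hom by blast
  then have "v \<cdot> u \<in> Arr C" "Dom C (v \<cdot> u) = X" "Cod C (v \<cdot> u) = Y" by (simp_all add: Hom_iff)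
  then show ?thesis using assms unfolding zero_arrow_def by blast
qed

lemma zero_arrow_comp_left:
  assumes "zero_arrow C f" "f \<in> Hom C X Y" "g \<in> Hom C Y W"
  shows "zero_arrow C (g \<cdot> f)"
proof -
  obtain Z u v where z: "zero_object C Z" "u \<in> Hom C X Z" "v \<in> Hom C Z Y" "f = v \<cdot> u"
    using assms zero_arrowE by metis
  have "g \<cdot> f = (g \<cdot> v) \<cdot> u" using z assms Comp_assoc by metis
  then show ?thesis using z assms zero_arrowI Comp_Hom by metis
qed

lemma zero_arrow_comp_right:
  assumes "zero_arrow C f" "f \<in> Hom C X Y" "g \<in> Hom C W X"
  shows "zero_arrow C (f \<cdot> g)"
proof -
  obtain Z u v where z: "zero_object C Z" "u \<in> Hom C X Z" "v \<in> Hom C Z Y" "f = v \<cdot> u"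
    using assms zero_arrowE by metis
  have "f \<cdot> g = v \<cdot> (u \<cdot> g)" using z assms Comp_assoc by metis
  then show ?thesis using z assms zero_arrowI Comp_Hom by metis
qed

lemma zero_object_ex1:
  assumes "zero_object C Z" "X \<in> Obj C"
  shows "\<exists>!f. f \<in> Hom C X Z" "\<exists>!f. f \<in> Hom C Z X"
  using assms by (auto simp: zero_object_def)

text \<open>An arrow W -> Z between two zero objects turns a factorization through W into one
  through Z, because arrows out of W and arrows into Z are unique. The zero object and both legs can
  thus be prescribed in advance.\<close>

lemma zero_arrow_via:
  assumes "zero_arrow C f" "f \<in> Hom C X Y" "zero_object C Z"
    "u \<in> Hom C X Z" "v \<in> Hom C Z Y"
  shows "f = v \<cdot> u"
proof -
  obtain W p q where z: "zero_object C W" "p \<in> Hom C X W" "q \<in> Hom C W Y" "f = q \<cdot> p"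
    using assms zero_arrowE by metis
  have o: "W \<in> Obj C" "X \<in> Obj C" "Y \<in> Obj C" using z Hom_Obj by blast+
  obtain k where k: "k \<in> Hom C W Z" using zero_object_ex1 assms(3) o by blast
  have "v \<cdot> k = q" using zero_object_ex1(2)[OF z(1) o(3)] z(3) Comp_Hom[OF k assms(5)] by blast
  moreover have "k \<cdot> p = u"
    using zero_object_ex1(1)[OF assms(3) o(2)] assms(4) Comp_Hom[OF z(2) k] by blast
  ultimately show ?thesis using Comp_assoc[OF z(2) k assms(5)] z(4) by simp
qed

lemma zero_arrow_unique:
  assumes "zero_arrow C f" "f \<in> Hom C X Y" "zero_arrow C g" "g \<in> Hom C X Y"
  shows "f = g"
  using zero_arrowE[OF assms(3,4)] zero_arrow_via[OF assms(1,2)] by metis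

lemma ex_zero_arrow:
  assumes "zero_object C Z" "X \<in> Obj C" "Y \<in> Obj C"
  shows "\<exists>f \<in> Hom C X Y. zero_arrow C f"
  using zero_object_ex1[OF assms(1)] assms zero_arrowI Comp_Hom by meson

section \<open>Kernels, cokernels, images and the subobjects they form\<close>

lemma is_kernel_cong:
  assumes "q \<in> Arr C" "q' \<in> Arr C" "Dom C q' = Dom C q"
    and z: "\<And>X g. g \<in> Hom C X (Dom C q) \<Longrightarrow> zero_arrow C (q \<cdot> g) \<longleftrightarrow> zero_arrow C (q' \<cdot> g)"
  shows "is_kernel C q k \<longleftrightarrow> is_kernel C q' k"
proof -
  have "k \<in> Arr C \<and> Cod C k = Dom C q \<longrightarrow> zero_arrow C (q \<cdot> k) = zero_arrow C (q' \<cdot> k)"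
    using z by (auto simp: Hom_iff)
  then show ?thesis using assms unfolding is_kernel_def by auto
qed

text \<open>The definition of a cokernel sees the arrow f only through its codomain and through the
  vanishing of composites t f. The domains of f and f' are unrelated.\<close>

lemma is_cokernel_cong:
  assumes "f \<in> Arr C" "f' \<in> Arr C" "Cod C f' = Cod C f"
    and z: "\<And>Y t. t \<in> Hom C (Cod C f) Y \<Longrightarrow> zero_arrow C (t \<cdot> f) \<longleftrightarrow> zero_arrow C (t \<cdot> f')"
  shows "is_cokernel C f q \<longleftrightarrow> is_cokernel C f' q"
proof -
  have "q \<in> Arr C \<and> Dom C q = Cod C f \<longrightarrow> zero_arrow C (q \<cdot> f) = zero_arrow C (q \<cdot> f')"
    using z by (auto simp: Hom_iff)
  then show ?thesis using assms unfolding is_cokernel_def by auto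
qed

text \<open>Equal sets of cokernels give literally equal unions of kernels. This is the criterion
  that ends the proof of the theorem, with f and f' two natural transformations into the identity of
  \<open>B\<close>.\<close>

lemma image_subobject_cong:
  assumes "f \<in> Arr C" "f' \<in> Arr C" "Cod C f' = Cod C f"
    and "\<And>Y t. t \<in> Hom C (Cod C f) Y \<Longrightarrow> zero_arrow C (t \<cdot> f) \<longleftrightarrow> zero_arrow C (t \<cdot> f')"
  shows "image_subobject C f = image_subobject C f'"
  using is_cokernel_cong[OF assms] by (simp add: image_subobject_def)

lemma cokernel_factor:
  assumes "is_cokernel C f q" "g \<in> Hom C (Cod C f) Y" "zero_arrow C (g \<cdot> f)"
  shows "\<exists>!u. u \<in> Hom C (Cod C q) Y \<and> u \<cdot> q = g"
  using assms unfolding is_cokernel_def by blast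

lemma cokernel_Hom: "is_cokernel C f q \<Longrightarrow> q \<in> Hom C (Cod C f) (Cod C q)"
  unfolding is_cokernel_def by (auto simp: Hom_iff)

lemma cokernel_zero: "is_cokernel C f q \<Longrightarrow> zero_arrow C (q \<cdot> f)"
  unfolding is_cokernel_def by blast

text \<open>The common composite u q annihilates f, and the universal property allows it only one
  factorization through q.\<close>

lemma cokernel_cancel:
  assumes q: "is_cokernel C f q" "u \<in> Hom C (Cod C q) Y" "v \<in> Hom C (Cod C q) Y" "u \<cdot> q = v \<cdot> q"
  shows "u = v"
proof -
  have f: "f \<in> Hom C (Dom C f) (Cod C f)" using q(1) unfolding is_cokernel_def by (simp add: Hom_iff)
  note qH = cokernel_Hom[OF q(1)]
  have "zero_arrow C (u \<cdot> (q \<cdot> f))"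
    using zero_arrow_comp_left[OF cokernel_zero[OF q(1)] Comp_Hom[OF f qH] q(2)] .
  then have "zero_arrow C ((u \<cdot> q) \<cdot> f)" using Comp_assoc[OF f qH q(2)] by simp
  with cokernel_factor[OF q(1) Comp_Hom[OF qH q(2)]] q show ?thesis by metis
qed

lemma kernel_factor:
  assumes "is_kernel C f k" "g \<in> Hom C X (Dom C f)" "zero_arrow C (f \<cdot> g)"
  shows "\<exists>!u. u \<in> Hom C X (Dom C k) \<and> k \<cdot> u = g"
  using assms unfolding is_kernel_def by blast

lemma kernel_Hom: "is_kernel C f k \<Longrightarrow> k \<in> Hom C (Dom C k) (Dom C f)"
  unfolding is_kernel_def by (auto simp: Hom_iff)

lemma kernel_zero: "is_kernel C f k \<Longrightarrow> zero_arrow C (f \<cdot> k)"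
  unfolding is_kernel_def by blast

lemma kernel_cancel:
  assumes k: "is_kernel C f k" "u \<in> Hom C X (Dom C k)" "v \<in> Hom C X (Dom C k)" "k \<cdot> u = k \<cdot> v"
  shows "u = v"
proof -
  have f: "f \<in> Hom C (Dom C f) (Cod C f)" using k(1) unfolding is_kernel_def by (simp add: Hom_iff)
  note kH = kernel_Hom[OF k(1)]
  have "zero_arrow C ((f \<cdot> k) \<cdot> u)"
    using zero_arrow_comp_right[OF kernel_zero[OF k(1)] Comp_Hom[OF kH f] k(2)] .
  then have "zero_arrow C (f \<cdot> (k \<cdot> u))" using Comp_assoc[OF k(2) kH f] by simp
  with kernel_factor[OF k(1) Comp_Hom[OF k(2) kH]] k show ?thesis by metis
qed

lemma kernel_monic: "is_kernel C f k \<Longrightarrow> monic C k"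
  unfolding monic_def using kernel_cancel by (auto simp: is_kernel_def)

text \<open>Any cokernel of f factors through any other. Together with \<open>is_kernel_cong\<close>
  this collapses the union over all cokernels in \<open>image_subobject\<close> to the kernels of a
  single one.\<close>

lemma cokernel_same_annihilators:
  assumes q: "is_cokernel C f q" "is_cokernel C f q'" and g: "g \<in> Hom C X (Cod C f)"
    and z: "zero_arrow C (q \<cdot> g)"
  shows "zero_arrow C (q' \<cdot> g)"
proof -
  note H = cokernel_Hom[OF q(1)]
  obtain u where u: "u \<in> Hom C (Cod C q) (Cod C q')" "u \<cdot> q = q'"
    using cokernel_factor[OF q(1) cokernel_Hom[OF q(2)] cokernel_zero[OF q(2)]] by blast
  have "zero_arrow C (u \<cdot> (q \<cdot> g))" using zero_arrow_comp_left[OF z Comp_Hom[OF g H] u(1)] .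
  then show ?thesis using Comp_assoc[OF g H u(1)] u(2) by simp
qed

lemma kernel_of_cokernel_unique:
  assumes "is_cokernel C f q" "is_cokernel C f q'"
  shows "is_kernel C q k \<longleftrightarrow> is_kernel C q' k"
  using assms cokernel_same_annihilators[of f q q'] cokernel_same_annihilators[of f q' q]
  by (intro is_kernel_cong) (auto simp: is_cokernel_def)

text \<open>Two kernels of f factor through each other by the universal property. Conversely a monic
  k' with k' = k u and k = k' v inherits that property, since a factorization w through k becomes v
  w through k'. The kernels thus form a full equivalence class, which later puts \<alpha>_h into
  \<open>Pr A\<close>.\<close>

lemma kernel_iff_subobject_class:
  assumes k: "is_kernel C f k"
  shows "is_kernel C f k' \<longleftrightarrow> k' \<in> subobject_class C k"
proof
  assume k': "is_kernel C f k'"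
  have "factors_through C m m'" if "is_kernel C f m" "is_kernel C f m'" for m m'
    using kernel_factor[OF that(2) kernel_Hom kernel_zero, OF that(1) that(1)]
    unfolding factors_through_def by metis
  then show "k' \<in> subobject_class C k"
    using k k' kernel_monic[OF k'] by (auto simp: subobject_class_def is_kernel_def)
next
  assume "k' \<in> subobject_class C k"
  then obtain u v where m: "monic C k'" "Cod C k' = Cod C k"
    and u: "u \<in> Hom C (Dom C k') (Dom C k)" "k' = k \<cdot> u"
    and v: "v \<in> Hom C (Dom C k) (Dom C k')" "k = k' \<cdot> v"
    unfolding subobject_class_def factors_through_def by blast
  have f: "f \<in> Hom C (Dom C f) (Cod C f)" using k unfolding is_kernel_def by (simp add: Hom_iff)
  note kH = kernel_Hom[OF k]
  have k'H: "k' \<in> Hom C (Dom C k') (Dom C f)"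
    using m kH by (auto simp: monic_def Hom_iff)
  have "f \<cdot> k' = (f \<cdot> k) \<cdot> u" using Comp_assoc[OF u(1) kH f] u(2) by simp
  then have z: "zero_arrow C (f \<cdot> k')"
    using zero_arrow_comp_right[OF kernel_zero[OF k] Comp_Hom[OF kH f] u(1)] by simp
  have "\<exists>!w. w \<in> Hom C X (Dom C k') \<and> k' \<cdot> w = g"
    if g: "g \<in> Hom C X (Dom C f)" "zero_arrow C (f \<cdot> g)" for X g
  proof -
    obtain w where w: "w \<in> Hom C X (Dom C k)" "k \<cdot> w = g" using kernel_factor[OF k g] by blast
    have "k' \<cdot> (v \<cdot> w) = g" using Comp_assoc[OF w(1) v(1) k'H] v(2) w(2) by simp
    moreover have "v \<cdot> w \<in> Hom C X (Dom C k')" using Comp_Hom[OF w(1) v(1)] .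
    ultimately show ?thesis using m(1) unfolding monic_def by metis
  qed
  then show "is_kernel C f k'"
    using f k'H z unfolding is_kernel_def by (simp add: Hom_iff[of f] Hom_iff[of k'])
qed

lemma image_subobject_eq_kernels:
  assumes "is_cokernel C f q"
  shows "image_subobject C f = {k. is_kernel C q k}"
  unfolding image_subobject_def kernel_subobject_def
  using assms kernel_of_cokernel_unique[OF assms] by blast

section \<open>Arrows out of a coproduct\<close>

lemma coproduct_incl:
  assumes "is_coproduct C I X Q q" "i \<in> I" shows "q i \<in> Hom C (X i) Q"
  using assms(1)[unfolded is_coproduct_def, THEN conjunct2, THEN conjunct1] assms(2) by (rule bspec)

lemma coproduct_ex1:
  assumes "is_coproduct C I X Q q" "Y \<in> Obj C" "\<And>i. i \<in> I \<Longrightarrow> g i \<in> Hom C (X i) Y"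
  shows "\<exists>!u. u \<in> Hom C Q Y \<and> (\<forall>i \<in> I. u \<cdot> q i = g i)"
proof -
  have "(\<forall>i \<in> I. g i \<in> Hom C (X i) Y) \<longrightarrow> (\<exists>!u. u \<in> Hom C Q Y \<and> (\<forall>i \<in> I. u \<cdot> q i = g i))"
    by (rule spec[OF bspec[OF assms(1)[unfolded is_coproduct_def, THEN conjunct2, THEN conjunct2] assms(2)]])
  then show ?thesis by (rule mp) (intro ballI assms(3))
qed

lemma coproduct_eqI:
  assumes q: "is_coproduct C I X Q q" and u: "u \<in> Hom C Q Y" and v: "v \<in> Hom C Q Y"
    and eq: "\<And>i. i \<in> I \<Longrightarrow> u \<cdot> q i = v \<cdot> q i"
  shows "u = v"
proof -
  note e = coproduct_ex1[OF q Hom_Obj(2)[OF u], of "\<lambda>i. v \<cdot> q i", OF Comp_Hom[OF coproduct_incl[OF q] v]]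
  show ?thesis
    by (rule trans[OF the1_equality[OF e, symmetric] the1_equality[OF e]]) (simp_all add: u v eq)
qed

text \<open>From right to left, u is compared with a zero arrow w with the same ends: zero arrows
  with given ends are unique, so u and w agree on every inclusion.\<close>

lemma coproduct_zero_iff:
  assumes q: "is_coproduct C I X Q q" and Z: "zero_object C Z" and u: "u \<in> Hom C Q Y"
  shows "zero_arrow C u \<longleftrightarrow> (\<forall>i \<in> I. zero_arrow C (u \<cdot> q i))"
proof -
  note qH = coproduct_incl[OF q]
  have o: "Q \<in> Obj C" "Y \<in> Obj C" using u Hom_Obj by blast+
  show ?thesis
  proof
    assume "zero_arrow C u"
    then show "\<forall>i \<in> I. zero_arrow C (u \<cdot> q i)"
      by (intro ballI zero_arrow_comp_right[OF _ u qH])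
  next
    assume z: "\<forall>i \<in> I. zero_arrow C (u \<cdot> q i)"
    obtain w where w: "w \<in> Hom C Q Y" "zero_arrow C w" using ex_zero_arrow[OF Z o] by blast
    have uq: "u \<cdot> q i \<in> Hom C (X i) Y" if "i \<in> I" for i using Comp_Hom[OF qH[OF that] u] .
    have wu: "\<forall>i \<in> I. w \<cdot> q i = u \<cdot> q i"
    proof
      fix i assume i: "i \<in> I"
      show "w \<cdot> q i = u \<cdot> q i"
        by (rule zero_arrow_unique[OF zero_arrow_comp_right[OF w(2,1) qH[OF i]]
              Comp_Hom[OF qH[OF i] w(1)] bspec[OF z i] uq[OF i]])
    qed
    have "u = w"
      by (rule coproduct_eqI[OF q u w(1)]) (use wu in simp)
    then show "zero_arrow C u" using w(2) by simp
  qed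
qed

end

section \<open>Functor categories\<close>

lemma functor_Obj: "is_functor C D F \<Longrightarrow> X \<in> Obj C \<Longrightarrow> omap F X \<in> Obj D"
  by (auto simp: is_functor_def)

lemma functor_Hom: "is_functor C D F \<Longrightarrow> f \<in> Hom C X Y \<Longrightarrow> amap F f \<in> Hom D (omap F X) (omap F Y)"
  by (auto simp: is_functor_def Hom_iff)

lemma functor_Comp:
  "is_functor C D F \<Longrightarrow> f \<in> Hom C X Y \<Longrightarrow> g \<in> Hom C Y Z \<Longrightarrow>
    amap F (g \<cdot>\<^bsub>C\<^esub> f) = amap F g \<cdot>\<^bsub>D\<^esub> amap F f"
  by (auto simp: is_functor_def Hom_iff)

lemma functor_Idt: "is_functor C D F \<Longrightarrow> X \<in> Obj C \<Longrightarrow> amap F (Idt C X) = Idt D (omap F X)"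
  by (auto simp: is_functor_def)

lemma nattr_Hom:
  "is_nattr C D t \<Longrightarrow> X \<in> Obj C \<Longrightarrow> component t X \<in> Hom D (omap (src t) X) (omap (tgt t) X)"
  by (auto simp: is_nattr_def)

lemma nattr_natural:
  "is_nattr C D t \<Longrightarrow> f \<in> Hom C X Y \<Longrightarrow>
    component t Y \<cdot>\<^bsub>D\<^esub> amap (src t) f = amap (tgt t) f \<cdot>\<^bsub>D\<^esub> component t X"
  by (auto simp: is_nattr_def Hom_iff)

lemma nattr_eqI:
  assumes "is_nattr C D s" "is_nattr C D t" "src s = src t" "tgt s = tgt t"
    "\<And>X. X \<in> Obj C \<Longrightarrow> component s X = component t X"
  shows "s = t"
proof -
  have "component s \<in> extensional (Obj C)" "component t \<in> extensional (Obj C)"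
    using assms(1,2) unfolding is_nattr_def by blast+
  then have "component s = component t" by (rule extensionalityI) (rule assms(5))
  then show ?thesis using assms by simp
qed

lemma Fun_simps [simp]:
  "Obj (Fun C D) = {F. is_functor C D F}" "Arr (Fun C D) = {t. is_nattr C D t}"
  "Dom (Fun C D) = src" "Cod (Fun C D) = tgt"
  by (simp_all add: Fun_def)

lemma Fun_Idt:
  "Idt (Fun C D) F = \<lparr>src = F, tgt = F, component = (\<lambda>X \<in> Obj C. Idt D (omap F X))\<rparr>"
  by (simp add: Fun_def)

lemma Fun_Comp:
  "s \<cdot>\<^bsub>Fun C D\<^esub> t = \<lparr>src = src t, tgt = tgt s,
     component = (\<lambda>X \<in> Obj C. component s X \<cdot>\<^bsub>D\<^esub> component t X)\<rparr>"
  by (simp add: Fun_def)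

lemma Fun_Comp_component [simp]:
  "X \<in> Obj C \<Longrightarrow> component (s \<cdot>\<^bsub>Fun C D\<^esub> t) X = component s X \<cdot>\<^bsub>D\<^esub> component t X"
  by (simp add: Fun_Comp)

lemma Hom_Fun: "t \<in> Hom (Fun C D) S T \<longleftrightarrow> is_nattr C D t \<and> src t = S \<and> tgt t = T"
  by (simp add: Hom_iff)

text \<open>Zero objects and the kernels or cokernels of components enter as hypotheses of
  individual lemmas. The locale serves endofunctors of \<open>A\<close> and of \<open>B\<close> as
  well as functors from \<open>B\<close> to \<open>A\<close>.\<close>

locale functor_category = C: category C + D: category D
  for C :: "('o1, 'm1) cat" and D :: "('o2, 'm2) cat"
begin

lemma functorI:
  assumes "\<And>X. X \<in> Obj C \<Longrightarrow> O' X \<in> Obj D"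
    and H: "\<And>X Y f. f \<in> Hom C X Y \<Longrightarrow> H f \<in> Hom D (O' X) (O' Y)"
    and "\<And>X. X \<in> Obj C \<Longrightarrow> H (Idt C X) = Idt D (O' X)"
    and c: "\<And>X Y Z f g. f \<in> Hom C X Y \<Longrightarrow> g \<in> Hom C Y Z \<Longrightarrow> H (g \<cdot>\<^bsub>C\<^esub> f) = H g \<cdot>\<^bsub>D\<^esub> H f"
  shows "is_functor C D \<lparr>omap = restrict O' (Obj C), amap = restrict H (Arr C)\<rparr>"
proof -
  have "H f \<in> Hom D (O' (Dom C f)) (O' (Cod C f))" if "f \<in> Arr C" for f
    using H[OF C.Arr_Hom[OF that]] .
  moreover have "H (g \<cdot>\<^bsub>C\<^esub> f) = H g \<cdot>\<^bsub>D\<^esub> H f \<and> g \<cdot>\<^bsub>C\<^esub> f \<in> Arr C"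
    if "f \<in> Arr C" "g \<in> Arr C" "Cod C f = Dom C g" for f g
    using c C.Comp_Hom C.Arr_Hom that by (metis Hom_iff)
  moreover have "Idt C X \<in> Arr C" if "X \<in> Obj C" for X
    using C.Idt_Hom[OF that] by (simp add: Hom_iff)
  ultimately show ?thesis
    using assms(1,3) C.Dom_Obj C.Cod_Obj unfolding is_functor_def by (auto simp: Hom_iff)
qed

lemma nattrI:
  assumes "is_functor C D S" "is_functor C D T"
    and k: "\<And>X. X \<in> Obj C \<Longrightarrow> k X \<in> Hom D (omap S X) (omap T X)"
    and n: "\<And>X Y f. f \<in> Hom C X Y \<Longrightarrow> k Y \<cdot>\<^bsub>D\<^esub> amap S f = amap T f \<cdot>\<^bsub>D\<^esub> k X"
  shows "is_nattr C D \<lparr>src = S, tgt = T, component = restrict k (Obj C)\<rparr>"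
  using assms(1,2) k n[OF C.Arr_Hom] C.Dom_Obj C.Cod_Obj unfolding is_nattr_def by auto

lemma Fun_Comp_Hom:
  assumes t: "t \<in> Hom (Fun C D) R S" and s: "s \<in> Hom (Fun C D) S T"
  shows "s \<cdot>\<^bsub>Fun C D\<^esub> t \<in> Hom (Fun C D) R T"
proof -
  have t': "is_nattr C D t" "src t = R" "tgt t = S" and s': "is_nattr C D s" "src s = S" "tgt s = T"
    using t s by (auto simp: Hom_Fun)
  have F: "is_functor C D R" "is_functor C D S" "is_functor C D T"
    using t' s' by (auto simp: is_nattr_def)
  have tH: "component t X \<in> Hom D (omap R X) (omap S X)"
    and sH: "component s X \<in> Hom D (omap S X) (omap T X)" if "X \<in> Obj C" for X
    using nattr_Hom[OF t'(1) that] nattr_Hom[OF s'(1) that] t' s' by auto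
  have "is_nattr C D \<lparr>src = R, tgt = T,
     component = (\<lambda>X \<in> Obj C. component s X \<cdot>\<^bsub>D\<^esub> component t X)\<rparr>"
  proof (rule nattrI[OF F(1,3)])
    fix X Y f assume f: "f \<in> Hom C X Y"
    note o = C.Hom_Obj[OF f]
    have "(component s Y \<cdot>\<^bsub>D\<^esub> component t Y) \<cdot>\<^bsub>D\<^esub> amap R f
        = component s Y \<cdot>\<^bsub>D\<^esub> (amap S f \<cdot>\<^bsub>D\<^esub> component t X)"
      using D.Comp_assoc[OF functor_Hom[OF F(1) f] tH[OF o(2)] sH[OF o(2)]]
        nattr_natural[OF t'(1) f] t' by simp
    also have "\<dots> = (component s Y \<cdot>\<^bsub>D\<^esub> amap S f) \<cdot>\<^bsub>D\<^esub> component t X"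
      using D.Comp_assoc[OF tH[OF o(1)] functor_Hom[OF F(2) f] sH[OF o(2)]] by simp
    also have "\<dots> = amap T f \<cdot>\<^bsub>D\<^esub> (component s X \<cdot>\<^bsub>D\<^esub> component t X)"
      using D.Comp_assoc[OF tH[OF o(1)] sH[OF o(1)] functor_Hom[OF F(3) f]]
        nattr_natural[OF s'(1) f] s' by simp
    finally show "(component s Y \<cdot>\<^bsub>D\<^esub> component t Y) \<cdot>\<^bsub>D\<^esub> amap R f
        = amap T f \<cdot>\<^bsub>D\<^esub> (component s X \<cdot>\<^bsub>D\<^esub> component t X)" .
  qed (use D.Comp_Hom[OF tH sH] in blast)
  then show ?thesis using t' s' by (simp add: Hom_Fun Fun_Comp)
qed

lemma Fun_Idt_Hom:
  assumes "is_functor C D F" shows "Idt (Fun C D) F \<in> Hom (Fun C D) F F"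
proof -
  have "is_nattr C D \<lparr>src = F, tgt = F, component = (\<lambda>X \<in> Obj C. Idt D (omap F X))\<rparr>"
  proof (rule nattrI[OF assms assms])
    fix X Y f assume "f \<in> Hom C X Y"
    from functor_Hom[OF assms this]
    show "Idt D (omap F Y) \<cdot>\<^bsub>D\<^esub> amap F f = amap F f \<cdot>\<^bsub>D\<^esub> Idt D (omap F X)"
      using D.Comp_Idt D.Idt_Comp by simp
  qed (use D.Idt_Hom functor_Obj[OF assms] in blast)
  then show ?thesis by (simp add: Hom_Fun Fun_Idt)
qed

lemma Hom_Fun_component:
  "t \<in> Hom (Fun C D) S T \<Longrightarrow> X \<in> Obj C \<Longrightarrow> component t X \<in> Hom D (omap S X) (omap T X)"
  using nattr_Hom[of C D t X] by (auto simp: Hom_Fun)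

lemma Hom_Fun_eqI:
  assumes "s \<in> Hom (Fun C D) S T" "t \<in> Hom (Fun C D) S T"
    "\<And>X. X \<in> Obj C \<Longrightarrow> component s X = component t X"
  shows "s = t"
  using assms unfolding Hom_Fun by (intro nattr_eqI[of C D]) simp_all

text \<open>From here on every statement about zero arrows, kernels, cokernels and images applies to
  natural transformations. The laws are checked on components, which suffices because components are
  extensional.\<close>

sublocale Fun: category "Fun C D"
proof
  fix f X Y assume f: "f \<in> Hom (Fun C D) X Y"
  have F: "is_functor C D X" "is_functor C D Y" using f by (auto simp: Hom_Fun is_nattr_def)
  note c = Hom_Fun_component[OF f]
  show "f \<cdot>\<^bsub>Fun C D\<^esub> Idt (Fun C D) X = f"
    by (rule Hom_Fun_eqI[OF Fun_Comp_Hom[OF Fun_Idt_Hom[OF F(1)] f] f])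
      (use D.Comp_Idt[OF c] in \<open>simp add: Fun_Idt\<close>)
  show "Idt (Fun C D) Y \<cdot>\<^bsub>Fun C D\<^esub> f = f"
    by (rule Hom_Fun_eqI[OF Fun_Comp_Hom[OF f Fun_Idt_Hom[OF F(2)]] f])
      (use D.Idt_Comp[OF c] in \<open>simp add: Fun_Idt\<close>)
next
  fix f g k W X Y Z
  assume h: "f \<in> Hom (Fun C D) W X" "g \<in> Hom (Fun C D) X Y" "k \<in> Hom (Fun C D) Y Z"
  show "(k \<cdot>\<^bsub>Fun C D\<^esub> g) \<cdot>\<^bsub>Fun C D\<^esub> f = k \<cdot>\<^bsub>Fun C D\<^esub> (g \<cdot>\<^bsub>Fun C D\<^esub> f)"
    by (rule Hom_Fun_eqI[OF Fun_Comp_Hom[OF h(1) Fun_Comp_Hom[OF h(2,3)]]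
          Fun_Comp_Hom[OF Fun_Comp_Hom[OF h(1,2)] h(3)]])
      (use D.Comp_assoc[OF h[THEN Hom_Fun_component]] in simp)
next
  show "g \<cdot>\<^bsub>Fun C D\<^esub> f \<in> Hom (Fun C D) X Z"
    if "f \<in> Hom (Fun C D) X Y" "g \<in> Hom (Fun C D) Y Z" for f g X Y Z
    using Fun_Comp_Hom[OF that] .
qed (simp_all add: is_nattr_def Fun_Idt_Hom)

section \<open>The zero object, cokernels and kernels of a functor category\<close>

definition const_fctr :: "'o2 \<Rightarrow> ('o1, 'm1, 'o2, 'm2) fctr" where
  "const_fctr Z = \<lparr>omap = (\<lambda>X \<in> Obj C. Z), amap = (\<lambda>f \<in> Arr C. Idt D Z)\<rparr>"

lemma is_functor_const: "Z \<in> Obj D \<Longrightarrow> is_functor C D (const_fctr Z)"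
  unfolding const_fctr_def by (intro functorI) (auto simp: D.Comp_Idt[OF D.Idt_Hom] D.Idt_Hom)

text \<open>Each component is the unique arrow into Z, and both sides of a naturality square are
  arrows into Z, so naturality is automatic. With the dual lemma this makes the constant functor at
  Z a zero object of the functor category.\<close>

lemma ex1_to_const:
  assumes Z: "zero_object D Z" and F: "is_functor C D F"
  shows "\<exists>!t. t \<in> Hom (Fun C D) F (const_fctr Z)"
proof -
  have ZO: "Z \<in> Obj D" using Z by (simp add: zero_object_def)
  note K = is_functor_const[OF ZO]
  have o: "omap (const_fctr Z) X = Z" if "X \<in> Obj C" for X using that by (simp add: const_fctr_def)
  note u = D.zero_object_ex1(1)[OF Z functor_Obj[OF F]]
  define k where "k X = (THE f. f \<in> Hom D (omap F X) Z)" for X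
  have k: "k X \<in> Hom D (omap F X) Z" if "X \<in> Obj C" for X
    unfolding k_def using theI'[OF u[OF that]] .
  have "is_nattr C D \<lparr>src = F, tgt = const_fctr Z, component = restrict k (Obj C)\<rparr>"
  proof (rule nattrI[OF F K])
    fix X Y f assume f: "f \<in> Hom C X Y"
    note XY = C.Hom_Obj[OF f]
    show "k Y \<cdot>\<^bsub>D\<^esub> amap F f = amap (const_fctr Z) f \<cdot>\<^bsub>D\<^esub> k X"
      using u[OF XY(1)] D.Comp_Hom[OF functor_Hom[OF F f] k[OF XY(2)]]
        D.Comp_Hom[OF k[OF XY(1)], of "amap (const_fctr Z) f" Z] functor_Hom[OF K f] o XY by auto
  qed (use k o in auto)
  then have ex: "\<lparr>src = F, tgt = const_fctr Z, component = restrict k (Obj C)\<rparr>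
      \<in> Hom (Fun C D) F (const_fctr Z)" by (simp add: Hom_Fun)
  show ?thesis
  proof (rule ex1I, rule ex)
    fix t assume t: "t \<in> Hom (Fun C D) F (const_fctr Z)"
    show "t = \<lparr>src = F, tgt = const_fctr Z, component = restrict k (Obj C)\<rparr>"
    proof (rule Hom_Fun_eqI[OF t ex])
      fix X assume X: "X \<in> Obj C"
      have "component t X = k X"
        using ex1E[OF u[OF X]] Hom_Fun_component[OF t X] k[OF X] o[OF X] by metis
      then show "component t X = component \<lparr>src = F, tgt = const_fctr Z, component = restrict k (Obj C)\<rparr> X"
        using X by simp
    qed
  qed
qed

lemma ex1_from_const:
  assumes Z: "zero_object D Z" and F: "is_functor C D F"
  shows "\<exists>!t. t \<in> Hom (Fun C D) (const_fctr Z) F"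
proof -
  have ZO: "Z \<in> Obj D" using Z by (simp add: zero_object_def)
  note K = is_functor_const[OF ZO]
  have o: "omap (const_fctr Z) X = Z" if "X \<in> Obj C" for X using that by (simp add: const_fctr_def)
  note u = D.zero_object_ex1(2)[OF Z functor_Obj[OF F]]
  define k where "k X = (THE f. f \<in> Hom D Z (omap F X))" for X
  have k: "k X \<in> Hom D Z (omap F X)" if "X \<in> Obj C" for X
    unfolding k_def using theI'[OF u[OF that]] .
  have "is_nattr C D \<lparr>src = const_fctr Z, tgt = F, component = restrict k (Obj C)\<rparr>"
  proof (rule nattrI[OF K F])
    fix X Y f assume f: "f \<in> Hom C X Y"
    note XY = C.Hom_Obj[OF f]
    have c: "amap (const_fctr Z) f \<in> Hom D Z Z" using functor_Hom[OF K f] o XY by simp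
    show "k Y \<cdot>\<^bsub>D\<^esub> amap (const_fctr Z) f = amap F f \<cdot>\<^bsub>D\<^esub> k X"
      using u[OF XY(2)] D.Comp_Hom[OF k[OF XY(1)] functor_Hom[OF F f]]
        D.Comp_Hom[OF c k[OF XY(2)]] by auto
  qed (use k o in auto)
  then have ex: "\<lparr>src = const_fctr Z, tgt = F, component = restrict k (Obj C)\<rparr>
      \<in> Hom (Fun C D) (const_fctr Z) F" by (simp add: Hom_Fun)
  show ?thesis
  proof (rule ex1I, rule ex)
    fix t assume t: "t \<in> Hom (Fun C D) (const_fctr Z) F"
    show "t = \<lparr>src = const_fctr Z, tgt = F, component = restrict k (Obj C)\<rparr>"
    proof (rule Hom_Fun_eqI[OF t ex])
      fix X assume X: "X \<in> Obj C"
      have "component t X = k X"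
        using ex1E[OF u[OF X]] Hom_Fun_component[OF t X] k[OF X] o[OF X] by metis
      then show "component t X = component \<lparr>src = const_fctr Z, tgt = F, component = restrict k (Obj C)\<rparr> X"
        using X by simp
    qed
  qed
qed

lemma zero_object_const:
  assumes "zero_object D Z" shows "zero_object (Fun C D) (const_fctr Z)"
  using assms ex1_to_const[OF assms] ex1_from_const[OF assms] is_functor_const
  by (auto simp: zero_object_def)

text \<open>The arrows u and v to and from the constant functor give one natural transformation v u
  against which t is tested: it is the only zero arrow from S to T, and its component at X is the
  only zero arrow between the values of S and T at X.\<close>

lemma zero_arrow_Fun_iff:
  assumes Z: "zero_object D Z" and t: "t \<in> Hom (Fun C D) S T"
  shows "zero_arrow (Fun C D) t \<longleftrightarrow> (\<forall>X \<in> Obj C. zero_arrow D (component t X))"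
proof -
  note ZF = zero_object_const[OF Z]
  have ST: "is_functor C D S" "is_functor C D T" using t by (auto simp: Hom_Fun is_nattr_def)
  obtain u v where u: "u \<in> Hom (Fun C D) S (const_fctr Z)" and v: "v \<in> Hom (Fun C D) (const_fctr Z) T"
    using ex1_to_const[OF Z ST(1)] ex1_from_const[OF Z ST(2)] by blast
  have c: "component u X \<in> Hom D (omap S X) Z" "component v X \<in> Hom D Z (omap T X)"
    if "X \<in> Obj C" for X
    using Hom_Fun_component[OF u that] Hom_Fun_component[OF v that] that
    by (simp_all add: const_fctr_def)
  show ?thesis
  proof
    assume "zero_arrow (Fun C D) t"
    from Fun.zero_arrow_via[OF this t ZF u v]
    show "\<forall>X \<in> Obj C. zero_arrow D (component t X)"
      using D.zero_arrowI[OF Z c] by simp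
  next
    assume z: "\<forall>X \<in> Obj C. zero_arrow D (component t X)"
    have "t = v \<cdot>\<^bsub>Fun C D\<^esub> u"
    proof (rule Hom_Fun_eqI[OF t Fun_Comp_Hom[OF u v]])
      fix X assume X: "X \<in> Obj C"
      show "component t X = component (v \<cdot>\<^bsub>Fun C D\<^esub> u) X"
        using D.zero_arrow_via[OF _ Hom_Fun_component[OF t X] Z c[OF X]] z X by simp
    qed
    then show "zero_arrow (Fun C D) t" using Fun.zero_arrowI[OF ZF u v] by simp
  qed
qed

text \<open>A cokernel is chosen at every object, and the universal properties turn these choices
  into a functor and a natural transformation. The second half of the conclusion is the purpose of
  the construction: it factors single arrows out of the value of T at X, not only natural
  transformations out of T.\<close>

lemma ex_pointwise_cokernel:
  assumes Z: "zero_object D Z" and t: "t \<in> Hom (Fun C D) S T"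
    and ck: "\<And>X. X \<in> Obj C \<Longrightarrow> \<exists>q. is_cokernel D (component t X) q"
  shows "\<exists>q. is_cokernel (Fun C D) t q \<and>
    (\<forall>X \<in> Obj C. is_cokernel D (component t X) (component q X))"
proof -
  have T: "is_functor C D T" using t by (auto simp: Hom_Fun is_nattr_def)
  note tH = Hom_Fun_component[OF t]
  have tC: "Cod D (component t X) = omap T X" if "X \<in> Obj C" for X
    using tH[OF that] by (simp add: Hom_iff)
  obtain Q where Q: "\<And>X. X \<in> Obj C \<Longrightarrow> is_cokernel D (component t X) (Q X)" using ck by metis
  define K where "K X = Cod D (Q X)" for X
  have QH: "Q X \<in> Hom D (omap T X) (K X)" if "X \<in> Obj C" for X
    using D.cokernel_Hom[OF Q[OF that]] tC[OF that] by (simp add: K_def)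
  have can: "u = v" if "X \<in> Obj C" "u \<in> Hom D (K X) Y" "v \<in> Hom D (K X) Y"
    "u \<cdot>\<^bsub>D\<^esub> Q X = v \<cdot>\<^bsub>D\<^esub> Q X" for X Y u v
    using D.cokernel_cancel[OF Q[OF that(1)]] that by (simp add: K_def)
  have fac: "\<exists>u \<in> Hom D (K X) Y. u \<cdot>\<^bsub>D\<^esub> Q X = g"
    if "X \<in> Obj C" "g \<in> Hom D (omap T X) Y" "zero_arrow D (g \<cdot>\<^bsub>D\<^esub> component t X)" for X Y g
    using D.cokernel_factor[OF Q[OF that(1)]] that tC unfolding K_def by metis
  \<comment> \<open>By naturality of t, Q at the codomain of f composed with T f annihilates t at
    the domain of f. The arrow this induces between the chosen cokernels is the action of the
    quotient functor on f.\<close>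
  have "\<exists>u. u \<in> Hom D (K (Dom C f)) (K (Cod C f)) \<and>
      u \<cdot>\<^bsub>D\<^esub> Q (Dom C f) = Q (Cod C f) \<cdot>\<^bsub>D\<^esub> amap T f" if f: "f \<in> Arr C" for f
  proof -
    note f = C.Arr_Hom[OF f]
    note o = C.Hom_Obj[OF f]
    have S: "is_functor C D S" using t by (auto simp: Hom_Fun is_nattr_def)
    note Tf = functor_Hom[OF T f] and Sf = functor_Hom[OF S f]
    have "(Q (Cod C f) \<cdot>\<^bsub>D\<^esub> amap T f) \<cdot>\<^bsub>D\<^esub> component t (Dom C f)
      = Q (Cod C f) \<cdot>\<^bsub>D\<^esub> (component t (Cod C f) \<cdot>\<^bsub>D\<^esub> amap S f)"
      using D.Comp_assoc[OF tH[OF o(1)] Tf QH[OF o(2)]] nattr_natural[OF _ f, of D t] t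
      by (simp add: Hom_Fun)
    also have "\<dots> = (Q (Cod C f) \<cdot>\<^bsub>D\<^esub> component t (Cod C f)) \<cdot>\<^bsub>D\<^esub> amap S f"
      using D.Comp_assoc[OF Sf tH[OF o(2)] QH[OF o(2)]] by simp
    finally have "zero_arrow D ((Q (Cod C f) \<cdot>\<^bsub>D\<^esub> amap T f) \<cdot>\<^bsub>D\<^esub> component t (Dom C f))"
      using D.zero_arrow_comp_right[OF D.cokernel_zero[OF Q[OF o(2)]]
          D.Comp_Hom[OF tH[OF o(2)] QH[OF o(2)]] Sf] by simp
    from fac[OF o(1) D.Comp_Hom[OF Tf QH[OF o(2)]] this] show ?thesis by blast
  qed
  then obtain H where "\<And>f. f \<in> Arr C \<Longrightarrow> H f \<in> Hom D (K (Dom C f)) (K (Cod C f)) \<and>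
      H f \<cdot>\<^bsub>D\<^esub> Q (Dom C f) = Q (Cod C f) \<cdot>\<^bsub>D\<^esub> amap T f" by metis
  then have H: "H f \<in> Hom D (K X) (K Y)" "H f \<cdot>\<^bsub>D\<^esub> Q X = Q Y \<cdot>\<^bsub>D\<^esub> amap T f"
    if "f \<in> Hom C X Y" for f X Y using that by (auto simp: Hom_iff)
  define R where "R = \<lparr>omap = restrict K (Obj C), amap = restrict H (Arr C)\<rparr>"
  have RH: "amap R f = H f" if "f \<in> Hom C X Y" for f X Y using that by (simp add: R_def Hom_iff)
  have RO: "omap R X = K X" if "X \<in> Obj C" for X using that by (simp add: R_def)
  have R: "is_functor C D R"
    unfolding R_def
  proof (rule functorI[OF D.Hom_Obj(2)[OF QH] H(1)])
    fix X assume X: "X \<in> Obj C"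
    note i = C.Idt_Hom[OF X]
    have KX: "Idt D (K X) \<in> Hom D (K X) (K X)" using D.Idt_Hom D.Hom_Obj(2)[OF QH[OF X]] by blast
    show "H (Idt C X) = Idt D (K X)"
      by (rule can[OF X H(1)[OF i] KX])
        (use H(2)[OF i] functor_Idt[OF T X] D.Comp_Idt[OF QH[OF X]] D.Idt_Comp[OF QH[OF X]] in simp)
  next
    fix X Y W f g assume f: "f \<in> Hom C X Y" and g: "g \<in> Hom C Y W"
    note gf = C.Comp_Hom[OF f g]
    note X = C.Hom_Obj[OF f] and W = C.Hom_Obj(2)[OF g]
    have "H g \<cdot>\<^bsub>D\<^esub> (Q Y \<cdot>\<^bsub>D\<^esub> amap T f) = Q W \<cdot>\<^bsub>D\<^esub> (amap T g \<cdot>\<^bsub>D\<^esub> amap T f)"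
      using D.Comp_assoc[OF functor_Hom[OF T f] QH[OF X(2)] H(1)[OF g]] H(2)[OF g]
        D.Comp_assoc[OF functor_Hom[OF T f] functor_Hom[OF T g] QH[OF W]] by simp
    then show "H (g \<cdot>\<^bsub>C\<^esub> f) = H g \<cdot>\<^bsub>D\<^esub> H f"
      by (intro can[OF X(1) H(1)[OF gf] D.Comp_Hom[OF H(1)[OF f] H(1)[OF g]]])
        (simp add: H(2)[OF gf] functor_Comp[OF T f g] D.Comp_assoc[OF QH[OF X(1)] H(1)[OF f] H(1)[OF g]] H(2)[OF f])
  qed
  define q where "q = \<lparr>src = T, tgt = R, component = restrict Q (Obj C)\<rparr>"
  have qX: "component q X = Q X" if "X \<in> Obj C" for X using that by (simp add: q_def)
  have q: "q \<in> Hom (Fun C D) T R"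
    unfolding Hom_Fun q_def using nattrI[OF T R] QH H(2) RH RO by simp
  have qt: "q \<cdot>\<^bsub>Fun C D\<^esub> t \<in> Hom (Fun C D) S R" using Fun_Comp_Hom[OF t q] .
  have "is_cokernel (Fun C D) t q"
    unfolding is_cokernel_def
  proof (intro conjI allI ballI impI)
    show "zero_arrow (Fun C D) (q \<cdot>\<^bsub>Fun C D\<^esub> t)"
      unfolding zero_arrow_Fun_iff[OF Z qt] using D.cokernel_zero[OF Q] qX by simp
    fix Y g assume "g \<in> Hom (Fun C D) (Cod (Fun C D) t) Y"
    then have g: "g \<in> Hom (Fun C D) T Y" using t by (simp add: Hom_Fun)
    have Y: "is_functor C D Y" using g by (auto simp: Hom_Fun is_nattr_def)
    assume z: "zero_arrow (Fun C D) (g \<cdot>\<^bsub>Fun C D\<^esub> t)"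
    have "\<exists>u. u \<in> Hom D (K X) (omap Y X) \<and> u \<cdot>\<^bsub>D\<^esub> Q X = component g X" if X: "X \<in> Obj C" for X
      using fac[OF X Hom_Fun_component[OF g X]] z[unfolded zero_arrow_Fun_iff[OF Z Fun_Comp_Hom[OF t g]]] X
      by auto
    then obtain u where u: "\<And>X. X \<in> Obj C \<Longrightarrow> u X \<in> Hom D (K X) (omap Y X)"
      "\<And>X. X \<in> Obj C \<Longrightarrow> u X \<cdot>\<^bsub>D\<^esub> Q X = component g X" by metis
    define w where "w = \<lparr>src = R, tgt = Y, component = restrict u (Obj C)\<rparr>"
    \<comment> \<open>Precomposed with the epic Q X, both sides of the square become the two sides
      of the naturality square of g.\<close>
    have "is_nattr C D w"
      unfolding w_def
    proof (rule nattrI[OF R Y])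
      fix X X' f assume f: "f \<in> Hom C X X'"
      note X = C.Hom_Obj[OF f]
      note Yf = functor_Hom[OF Y f]
      have "(u X' \<cdot>\<^bsub>D\<^esub> H f) \<cdot>\<^bsub>D\<^esub> Q X = u X' \<cdot>\<^bsub>D\<^esub> (Q X' \<cdot>\<^bsub>D\<^esub> amap T f)"
        using D.Comp_assoc[OF QH[OF X(1)] H(1)[OF f] u(1)[OF X(2)]] H(2)[OF f] by simp
      also have "\<dots> = component g X' \<cdot>\<^bsub>D\<^esub> amap T f"
        using D.Comp_assoc[OF functor_Hom[OF T f] QH[OF X(2)] u(1)[OF X(2)]] u(2)[OF X(2)] by simp
      also have "\<dots> = amap Y f \<cdot>\<^bsub>D\<^esub> component g X"
        using nattr_natural[OF _ f, of D g] g by (simp add: Hom_Fun)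
      also have "\<dots> = (amap Y f \<cdot>\<^bsub>D\<^esub> u X) \<cdot>\<^bsub>D\<^esub> Q X"
        using D.Comp_assoc[OF QH[OF X(1)] u(1)[OF X(1)] Yf] u(2)[OF X(1)] by simp
      finally have "u X' \<cdot>\<^bsub>D\<^esub> H f = amap Y f \<cdot>\<^bsub>D\<^esub> u X"
        using can[OF X(1) D.Comp_Hom[OF H(1)[OF f] u(1)[OF X(2)]] D.Comp_Hom[OF u(1)[OF X(1)] Yf]] by simp
      then show "u X' \<cdot>\<^bsub>D\<^esub> amap R f = amap Y f \<cdot>\<^bsub>D\<^esub> u X" using RH[OF f] by simp
    qed (use u RO in simp)
    then have w: "w \<in> Hom (Fun C D) R Y" by (simp add: Hom_Fun w_def)
    have wq: "w \<cdot>\<^bsub>Fun C D\<^esub> q = g"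
      by (rule Hom_Fun_eqI[OF Fun_Comp_Hom[OF q w] g]) (use u(2) qX in \<open>simp add: w_def\<close>)
    show "\<exists>!u. u \<in> Hom (Fun C D) (Cod (Fun C D) q) Y \<and> u \<cdot>\<^bsub>Fun C D\<^esub> q = g"
    proof (rule ex1I[of _ w])
      show "w \<in> Hom (Fun C D) (Cod (Fun C D) q) Y \<and> w \<cdot>\<^bsub>Fun C D\<^esub> q = g" using w wq by (simp add: q_def)
      fix v assume "v \<in> Hom (Fun C D) (Cod (Fun C D) q) Y \<and> v \<cdot>\<^bsub>Fun C D\<^esub> q = g"
      then have v: "v \<in> Hom (Fun C D) R Y" "v \<cdot>\<^bsub>Fun C D\<^esub> q = g" by (auto simp: q_def)
      show "v = w"
      proof (rule Hom_Fun_eqI[OF v(1) w])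
        fix X assume X: "X \<in> Obj C"
        have "component v X \<cdot>\<^bsub>D\<^esub> Q X = component w X \<cdot>\<^bsub>D\<^esub> Q X"
          using v(2) wq qX X by (metis Fun_Comp_component)
        then show "component v X = component w X"
          using can[OF X] Hom_Fun_component[OF v(1) X] Hom_Fun_component[OF w X] RO[OF X] by metis
      qed
    qed
  qed (use t q in \<open>auto simp: Hom_Fun\<close>)
  then show ?thesis using Q qX by auto
qed

text \<open>Dual to the construction of cokernels, with monics Q X in place of epics. It is applied
  to the cokernel of a_h, so that the class \<alpha>_h has a member.\<close>

lemma ex_Fun_kernel:
  assumes Z: "zero_object D Z" and t: "t \<in> Hom (Fun C D) S T"
    and ck: "\<And>X. X \<in> Obj C \<Longrightarrow> \<exists>k. is_kernel D (component t X) k"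
  shows "\<exists>k. is_kernel (Fun C D) t k"
proof -
  have S: "is_functor C D S" and T: "is_functor C D T" using t by (auto simp: Hom_Fun is_nattr_def)
  note tH = Hom_Fun_component[OF t]
  have tC: "Dom D (component t X) = omap S X" if "X \<in> Obj C" for X
    using tH[OF that] by (simp add: Hom_iff)
  obtain Q where Q: "\<And>X. X \<in> Obj C \<Longrightarrow> is_kernel D (component t X) (Q X)" using ck by metis
  define K where "K X = Dom D (Q X)" for X
  have QH: "Q X \<in> Hom D (K X) (omap S X)" if "X \<in> Obj C" for X
    using D.kernel_Hom[OF Q[OF that]] tC[OF that] by (simp add: K_def)
  have can: "u = v" if "X \<in> Obj C" "u \<in> Hom D Y (K X)" "v \<in> Hom D Y (K X)"
    "Q X \<cdot>\<^bsub>D\<^esub> u = Q X \<cdot>\<^bsub>D\<^esub> v" for X Y u v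
    using D.kernel_cancel[OF Q[OF that(1)]] that by (simp add: K_def)
  have fac: "\<exists>u \<in> Hom D Y (K X). Q X \<cdot>\<^bsub>D\<^esub> u = g"
    if "X \<in> Obj C" "g \<in> Hom D Y (omap S X)" "zero_arrow D (component t X \<cdot>\<^bsub>D\<^esub> g)" for X Y g
    using D.kernel_factor[OF Q[OF that(1)]] that tC unfolding K_def by metis
  have "\<exists>u. u \<in> Hom D (K (Dom C f)) (K (Cod C f)) \<and>
      Q (Cod C f) \<cdot>\<^bsub>D\<^esub> u = amap S f \<cdot>\<^bsub>D\<^esub> Q (Dom C f)" if f: "f \<in> Arr C" for f
  proof -
    note f = C.Arr_Hom[OF f]
    note o = C.Hom_Obj[OF f]
    note Tf = functor_Hom[OF T f] and Sf = functor_Hom[OF S f]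
    have "component t (Cod C f) \<cdot>\<^bsub>D\<^esub> (amap S f \<cdot>\<^bsub>D\<^esub> Q (Dom C f))
      = (amap T f \<cdot>\<^bsub>D\<^esub> component t (Dom C f)) \<cdot>\<^bsub>D\<^esub> Q (Dom C f)"
      using D.Comp_assoc[OF QH[OF o(1)] Sf tH[OF o(2)]] nattr_natural[OF _ f, of D t] t
      by (simp add: Hom_Fun)
    also have "\<dots> = amap T f \<cdot>\<^bsub>D\<^esub> (component t (Dom C f) \<cdot>\<^bsub>D\<^esub> Q (Dom C f))"
      using D.Comp_assoc[OF QH[OF o(1)] tH[OF o(1)] Tf] by simp
    finally have "zero_arrow D (component t (Cod C f) \<cdot>\<^bsub>D\<^esub> (amap S f \<cdot>\<^bsub>D\<^esub> Q (Dom C f)))"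
      using D.zero_arrow_comp_left[OF D.kernel_zero[OF Q[OF o(1)]]
          D.Comp_Hom[OF QH[OF o(1)] tH[OF o(1)]] Tf] by simp
    from fac[OF o(2) D.Comp_Hom[OF QH[OF o(1)] Sf] this] show ?thesis by blast
  qed
  then obtain H where "\<And>f. f \<in> Arr C \<Longrightarrow> H f \<in> Hom D (K (Dom C f)) (K (Cod C f)) \<and>
      Q (Cod C f) \<cdot>\<^bsub>D\<^esub> H f = amap S f \<cdot>\<^bsub>D\<^esub> Q (Dom C f)" by metis
  then have H: "H f \<in> Hom D (K X) (K Y)" "Q Y \<cdot>\<^bsub>D\<^esub> H f = amap S f \<cdot>\<^bsub>D\<^esub> Q X"
    if "f \<in> Hom C X Y" for f X Y using that by (auto simp: Hom_iff)
  define R where "R = \<lparr>omap = restrict K (Obj C), amap = restrict H (Arr C)\<rparr>"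
  have RH: "amap R f = H f" if "f \<in> Hom C X Y" for f X Y using that by (simp add: R_def Hom_iff)
  have RO: "omap R X = K X" if "X \<in> Obj C" for X using that by (simp add: R_def)
  have R: "is_functor C D R"
    unfolding R_def
  proof (rule functorI[OF D.Hom_Obj(1)[OF QH] H(1)])
    fix X assume X: "X \<in> Obj C"
    note i = C.Idt_Hom[OF X]
    have KX: "Idt D (K X) \<in> Hom D (K X) (K X)" using D.Idt_Hom D.Hom_Obj(1)[OF QH[OF X]] by blast
    show "H (Idt C X) = Idt D (K X)"
      by (rule can[OF X H(1)[OF i] KX])
        (use H(2)[OF i] functor_Idt[OF S X] D.Comp_Idt[OF QH[OF X]] D.Idt_Comp[OF QH[OF X]] in simp)
  next
    fix X Y W f g assume f: "f \<in> Hom C X Y" and g: "g \<in> Hom C Y W"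
    note gf = C.Comp_Hom[OF f g]
    note X = C.Hom_Obj[OF f] and W = C.Hom_Obj(2)[OF g]
    have "(amap S g \<cdot>\<^bsub>D\<^esub> Q Y) \<cdot>\<^bsub>D\<^esub> H f = (amap S g \<cdot>\<^bsub>D\<^esub> amap S f) \<cdot>\<^bsub>D\<^esub> Q X"
      using D.Comp_assoc[OF H(1)[OF f] QH[OF X(2)] functor_Hom[OF S g]] H(2)[OF f]
        D.Comp_assoc[OF QH[OF X(1)] functor_Hom[OF S f] functor_Hom[OF S g]] by simp
    then show "H (g \<cdot>\<^bsub>C\<^esub> f) = H g \<cdot>\<^bsub>D\<^esub> H f"
      by (intro can[OF W H(1)[OF gf] D.Comp_Hom[OF H(1)[OF f] H(1)[OF g]]])
        (simp add: H(2)[OF gf] functor_Comp[OF S f g] H(2)[OF g]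
          D.Comp_assoc[OF H(1)[OF f] H(1)[OF g] QH[OF W], symmetric])
  qed
  define q where "q = \<lparr>src = R, tgt = S, component = restrict Q (Obj C)\<rparr>"
  have qX: "component q X = Q X" if "X \<in> Obj C" for X using that by (simp add: q_def)
  have q: "q \<in> Hom (Fun C D) R S"
    unfolding Hom_Fun q_def using nattrI[OF R S] QH H(2) RH RO by simp
  have tq: "t \<cdot>\<^bsub>Fun C D\<^esub> q \<in> Hom (Fun C D) R T" using Fun_Comp_Hom[OF q t] .
  have "is_kernel (Fun C D) t q"
    unfolding is_kernel_def
  proof (intro conjI allI ballI impI)
    show "zero_arrow (Fun C D) (t \<cdot>\<^bsub>Fun C D\<^esub> q)"
      unfolding zero_arrow_Fun_iff[OF Z tq] using D.kernel_zero[OF Q] qX by simp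
    fix Y g assume "g \<in> Hom (Fun C D) Y (Dom (Fun C D) t)"
    then have g: "g \<in> Hom (Fun C D) Y S" using t by (simp add: Hom_Fun)
    have Y: "is_functor C D Y" using g by (auto simp: Hom_Fun is_nattr_def)
    assume z: "zero_arrow (Fun C D) (t \<cdot>\<^bsub>Fun C D\<^esub> g)"
    have "\<exists>u. u \<in> Hom D (omap Y X) (K X) \<and> Q X \<cdot>\<^bsub>D\<^esub> u = component g X" if X: "X \<in> Obj C" for X
      using fac[OF X Hom_Fun_component[OF g X]] z[unfolded zero_arrow_Fun_iff[OF Z Fun_Comp_Hom[OF g t]]] X
      by auto
    then obtain u where u: "\<And>X. X \<in> Obj C \<Longrightarrow> u X \<in> Hom D (omap Y X) (K X)"
      "\<And>X. X \<in> Obj C \<Longrightarrow> Q X \<cdot>\<^bsub>D\<^esub> u X = component g X" by metis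
    define w where "w = \<lparr>src = Y, tgt = R, component = restrict u (Obj C)\<rparr>"
    have "is_nattr C D w"
      unfolding w_def
    proof (rule nattrI[OF Y R])
      fix X X' f assume f: "f \<in> Hom C X X'"
      note X = C.Hom_Obj[OF f]
      note Yf = functor_Hom[OF Y f]
      have "Q X' \<cdot>\<^bsub>D\<^esub> (H f \<cdot>\<^bsub>D\<^esub> u X) = (amap S f \<cdot>\<^bsub>D\<^esub> Q X) \<cdot>\<^bsub>D\<^esub> u X"
        using D.Comp_assoc[OF u(1)[OF X(1)] H(1)[OF f] QH[OF X(2)]] H(2)[OF f] by simp
      also have "\<dots> = amap S f \<cdot>\<^bsub>D\<^esub> component g X"
        using D.Comp_assoc[OF u(1)[OF X(1)] QH[OF X(1)] functor_Hom[OF S f]] u(2)[OF X(1)] by simp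
      also have "\<dots> = component g X' \<cdot>\<^bsub>D\<^esub> amap Y f"
        using nattr_natural[OF _ f, of D g] g by (simp add: Hom_Fun)
      also have "\<dots> = Q X' \<cdot>\<^bsub>D\<^esub> (u X' \<cdot>\<^bsub>D\<^esub> amap Y f)"
        using D.Comp_assoc[OF Yf u(1)[OF X(2)] QH[OF X(2)]] u(2)[OF X(2)] by simp
      finally have "H f \<cdot>\<^bsub>D\<^esub> u X = u X' \<cdot>\<^bsub>D\<^esub> amap Y f"
        using can[OF X(2) D.Comp_Hom[OF u(1)[OF X(1)] H(1)[OF f]] D.Comp_Hom[OF Yf u(1)[OF X(2)]]] by simp
      then show "u X' \<cdot>\<^bsub>D\<^esub> amap Y f = amap R f \<cdot>\<^bsub>D\<^esub> u X" using RH[OF f] by simp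
    qed (use u RO in simp)
    then have w: "w \<in> Hom (Fun C D) Y R" by (simp add: Hom_Fun w_def)
    have wq: "q \<cdot>\<^bsub>Fun C D\<^esub> w = g"
      by (rule Hom_Fun_eqI[OF Fun_Comp_Hom[OF w q] g]) (use u(2) qX in \<open>simp add: w_def\<close>)
    show "\<exists>!u. u \<in> Hom (Fun C D) Y (Dom (Fun C D) q) \<and> q \<cdot>\<^bsub>Fun C D\<^esub> u = g"
    proof (rule ex1I[of _ w])
      show "w \<in> Hom (Fun C D) Y (Dom (Fun C D) q) \<and> q \<cdot>\<^bsub>Fun C D\<^esub> w = g" using w wq by (simp add: q_def)
      fix v assume "v \<in> Hom (Fun C D) Y (Dom (Fun C D) q) \<and> q \<cdot>\<^bsub>Fun C D\<^esub> v = g"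
      then have v: "v \<in> Hom (Fun C D) Y R" "q \<cdot>\<^bsub>Fun C D\<^esub> v = g" by (auto simp: q_def)
      show "v = w"
      proof (rule Hom_Fun_eqI[OF v(1) w])
        fix X assume X: "X \<in> Obj C"
        have "Q X \<cdot>\<^bsub>D\<^esub> component v X = Q X \<cdot>\<^bsub>D\<^esub> component w X"
          using v(2) wq qX X by (metis Fun_Comp_component)
        then show "component v X = component w X"
          using can[OF X] Hom_Fun_component[OF v(1) X] Hom_Fun_component[OF w X] RO[OF X] by metis
      qed
    qed
  qed (use t q in \<open>auto simp: Hom_Fun\<close>)
  then show ?thesis by blast
qed

end


lemma (in category) is_functor_id_fctr: "is_functor C C (id_fctr C)"
proof -
  interpret functor_category C C ..
  show ?thesis unfolding id_fctr_def by (rule functorI) auto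
qed

section \<open>Alpha preradicals\<close>

text \<open>A coproduct is a colimit over a discrete category. Since \<open>bicomplete\<close>
  speaks of index categories inside the type \<open>'u\<close>, the index set is first carried there
  by an injection e, which smallness of I provides.\<close>

lemma ex_coproduct:
  fixes U :: "'u set" and C :: "('o, 'm) cat" and I :: "'i set"
  assumes C: "category C" and bc: "bicomplete U C" and I: "small U I"
    and X: "\<And>i. i \<in> I \<Longrightarrow> X i \<in> Obj C"
  shows "\<exists>Q q. is_coproduct C I X Q q"
proof -
  interpret category C by fact
  obtain e :: "'i \<Rightarrow> 'u" where e: "inj_on e I"
    using I unfolding small_def lesspoll_def lepoll_def by blast
  define d where "d = the_inv_into I e"
  have de: "d (e i) = i" if "i \<in> I" for i
    using the_inv_into_f_f[OF e that] by (simp add: d_def)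
  \<comment> \<open>the discrete category on a copy of the index set inside the type of the universe\<close>
  define J :: "('u, 'u) cat" where
    "J = \<lparr>Obj = e ` I, Arr = e ` I, Dom = (\<lambda>x. x), Cod = (\<lambda>x. x), Idt = (\<lambda>x. x), Comp = (\<lambda>x y. x)\<rparr>"
  have J: "category J" by unfold_locales (auto simp: J_def Hom_def)
  have sm: "small U (e ` I)"
    using I unfolding small_def
    by (rule lesspoll_trans1[OF eqpoll_imp_lepoll[OF inj_on_image_eqpoll_self[OF e]]])
  define D where "D = \<lparr>omap = (\<lambda>j \<in> e ` I. X (d j)), amap = (\<lambda>j \<in> e ` I. Idt C (X (d j)))\<rparr>"
  have id: "Idt C (X i) \<in> Arr C" "Dom C (Idt C (X i)) = X i" "Cod C (Idt C (X i)) = X i"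
    "Idt C (X i) \<cdot>\<^bsub>C\<^esub> Idt C (X i) = Idt C (X i)" if "i \<in> I" for i
    using Idt_Hom[OF X[OF that]] Comp_Idt[OF Idt_Hom[OF X[OF that]]] by (simp_all add: Hom_iff)
  have D: "is_functor J C D"
    unfolding is_functor_def by (auto simp: D_def J_def de X id Hom_iff)
  obtain Q q where q: "is_colimit J C D Q q"
  proof -
    have "category J \<and> small U (Obj J) \<and> small U (Arr J) \<and> is_functor J C D"
      using J sm D by (simp add: J_def)
    then show thesis using bc that unfolding bicomplete_def by blast
  qed
  \<comment> \<open>Over a discrete category the compatibility condition concerns identities alone
    and reduces to \<open>Comp_Idt\<close>, so a cocone is just a family of arrows indexed by
    I.\<close>
  have cocone: "is_cocone J C D Y r \<longleftrightarrow> Y \<in> Obj C \<and> (\<forall>i \<in> I. r (e i) \<in> Hom C (X i) Y)" for Y r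
  proof -
    have "r (e i) \<cdot>\<^bsub>C\<^esub> Idt C (X i) = r (e i)" if "r (e i) \<in> Hom C (X i) Y" for i
      using Comp_Idt[OF that] .
    then show ?thesis unfolding is_cocone_def by (auto simp: J_def D_def de)
  qed
  have "is_coproduct C I X Q (\<lambda>i. q (e i))"
    unfolding is_coproduct_def
  proof (intro conjI ballI allI impI)
    have Q: "is_cocone J C D Q q" using q by (simp add: is_colimit_def)
    then show "Q \<in> Obj C" unfolding cocone by blast
    show "q (e i) \<in> Hom C (X i) Q" if "i \<in> I" for i using Q that unfolding cocone by blast
    fix Y g assume Y: "Y \<in> Obj C" and g: "\<forall>i \<in> I. g i \<in> Hom C (X i) Y"
    have "is_cocone J C D Y (\<lambda>j. g (d j))" unfolding cocone using Y g de by simp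
    then have "\<exists>!u. u \<in> Hom C Q Y \<and> (\<forall>j \<in> Obj J. u \<cdot>\<^bsub>C\<^esub> q j = g (d j))"
      using q unfolding is_colimit_def by blast
    then show "\<exists>!u. u \<in> Hom C Q Y \<and> (\<forall>i \<in> I. u \<cdot>\<^bsub>C\<^esub> q (e i) = g i)"
      using de by (simp add: J_def)
  qed
  then show ?thesis by blast
qed

lemma copower_coproduct:
  assumes "\<exists>Q q. is_coproduct C I (\<lambda>_. N) Q q"
  shows "is_coproduct C I (\<lambda>_. N) (fst (copower C N I)) (snd (copower C N I))"
proof -
  obtain Q q where "is_coproduct C I (\<lambda>_. N) Q q" using assms by blast
  then have "case (Q, q) of (Q, q) \<Rightarrow> is_coproduct C I (\<lambda>_. N) Q q" by simp
  from someI[of "\<lambda>x. case x of (Q, q) \<Rightarrow> is_coproduct C I (\<lambda>_. N) Q q", OF this]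
  show ?thesis unfolding copower_def[symmetric] by (simp add: case_prod_beta)
qed

text \<open>Copowers are assumed exactly for the index sets that occur in the alpha functor. The
  theorem interprets the locale twice, for h in \<open>A\<close> and for F(h) in
  \<open>B\<close>.\<close>

locale alpha = category C for C :: "('o, 'm) cat" +
  fixes N M :: 'o and h :: 'm
  assumes h: "h \<in> Hom C N M"
    and ex_copower: "\<And>L. L \<in> Obj C \<Longrightarrow> \<exists>Q q. is_coproduct C (Hom C M L) (\<lambda>_. N) Q q"
begin

sublocale FC: functor_category C C ..

lemma copr: "L \<in> Obj C \<Longrightarrow>
    is_coproduct C (Hom C M L) (\<lambda>_. N) (alpha_obj C N M L) (alpha_incl C N M L)"
  unfolding alpha_obj_def alpha_incl_def by (rule copower_coproduct[OF ex_copower])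

lemma incl_Hom: "f \<in> Hom C M L \<Longrightarrow> alpha_incl C N M L f \<in> Hom C N (alpha_obj C N M L)"
  by (rule coproduct_incl[OF copr]) (auto intro: Hom_Obj)

text \<open>The functor laws and the naturality of a_h are identities between arrows out of a
  copower, and all of them are checked on the inclusions.\<close>

lemma alpha_eqI:
  assumes "L \<in> Obj C" "u \<in> Hom C (alpha_obj C N M L) Y" "v \<in> Hom C (alpha_obj C N M L) Y"
    "\<And>f. f \<in> Hom C M L \<Longrightarrow> u \<cdot>\<^bsub>C\<^esub> alpha_incl C N M L f = v \<cdot>\<^bsub>C\<^esub> alpha_incl C N M L f"
  shows "u = v"
  by (rule coproduct_eqI[OF copr]) (use assms in auto)

lemma alpha_omap: "L \<in> Obj C \<Longrightarrow> omap (alpha_fctr C N M) L = alpha_obj C N M L"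
  by (simp add: alpha_fctr_def)

text \<open>The definite description inside \<open>alpha_fctr\<close>, named so that
  \<open>alpha_fctr_eq\<close> has the shape expected by \<open>functorI\<close>.\<close>

definition alpha_map :: "'m \<Rightarrow> 'm" where
  "alpha_map l = (THE u. u \<in> Hom C (alpha_obj C N M (Dom C l)) (alpha_obj C N M (Cod C l)) \<and>
          (\<forall>f \<in> Hom C M (Dom C l).
             u \<cdot>\<^bsub>C\<^esub> alpha_incl C N M (Dom C l) f = alpha_incl C N M (Cod C l) (l \<cdot>\<^bsub>C\<^esub> f)))"

lemma alpha_map:
  assumes l: "l \<in> Hom C L L'"
  shows alpha_map_Hom: "alpha_map l \<in> Hom C (alpha_obj C N M L) (alpha_obj C N M L')"
    and alpha_map_incl: "f \<in> Hom C M L \<Longrightarrow>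
      alpha_map l \<cdot>\<^bsub>C\<^esub> alpha_incl C N M L f = alpha_incl C N M L' (l \<cdot>\<^bsub>C\<^esub> f)"
proof -
  have DC: "Dom C l = L" "Cod C l = L'" using l by (auto simp: Hom_iff)
  note o = Hom_Obj[OF l]
  have "alpha_obj C N M L' \<in> Obj C" using copr[OF o(2)] by (simp add: is_coproduct_def)
  from theI'[OF coproduct_ex1[OF copr[OF o(1)] this, of "\<lambda>f. alpha_incl C N M L' (l \<cdot>\<^bsub>C\<^esub> f)",
        OF incl_Hom[OF Comp_Hom[OF _ l]]]]
  have "alpha_map l \<in> Hom C (alpha_obj C N M L) (alpha_obj C N M L') \<and> (\<forall>f \<in> Hom C M L.
      alpha_map l \<cdot>\<^bsub>C\<^esub> alpha_incl C N M L f = alpha_incl C N M L' (l \<cdot>\<^bsub>C\<^esub> f))"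
    unfolding alpha_map_def DC by simp
  then show "alpha_map l \<in> Hom C (alpha_obj C N M L) (alpha_obj C N M L')"
    "f \<in> Hom C M L \<Longrightarrow> alpha_map l \<cdot>\<^bsub>C\<^esub> alpha_incl C N M L f = alpha_incl C N M L' (l \<cdot>\<^bsub>C\<^esub> f)"
    by blast+
qed

lemma alpha_fctr_eq: "alpha_fctr C N M =
    \<lparr>omap = restrict (alpha_obj C N M) (Obj C), amap = restrict alpha_map (Arr C)\<rparr>"
  by (simp add: alpha_fctr_def alpha_map_def[abs_def])

lemma is_functor_alpha: "is_functor C C (alpha_fctr C N M)"
  unfolding alpha_fctr_eq
proof (rule FC.functorI)
  fix L assume L: "L \<in> Obj C"
  show o: "alpha_obj C N M L \<in> Obj C" using copr[OF L] by (simp add: is_coproduct_def)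
  note i = Idt_Hom[OF L]
  show "alpha_map (Idt C L) = Idt C (alpha_obj C N M L)"
    by (rule alpha_eqI[OF L alpha_map_Hom[OF i] Idt_Hom[OF o]])
      (simp add: alpha_map_incl[OF i] Idt_Comp[OF incl_Hom] Idt_Comp)
next
  fix X Y Z f g assume f: "f \<in> Hom C X Y" and g: "g \<in> Hom C Y Z"
  note gf = Comp_Hom[OF f g]
  show "alpha_map (g \<cdot>\<^bsub>C\<^esub> f) = alpha_map g \<cdot>\<^bsub>C\<^esub> alpha_map f"
  proof (rule alpha_eqI[OF Hom_Obj(1)[OF f] alpha_map_Hom[OF gf]
        Comp_Hom[OF alpha_map_Hom[OF f] alpha_map_Hom[OF g]]])
    fix k assume k: "k \<in> Hom C M X"
    show "alpha_map (g \<cdot>\<^bsub>C\<^esub> f) \<cdot>\<^bsub>C\<^esub> alpha_incl C N M X k =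
        (alpha_map g \<cdot>\<^bsub>C\<^esub> alpha_map f) \<cdot>\<^bsub>C\<^esub> alpha_incl C N M X k"
      unfolding alpha_map_incl[OF gf k] Comp_assoc[OF incl_Hom[OF k] alpha_map_Hom[OF f] alpha_map_Hom[OF g]]
        alpha_map_incl[OF f k] alpha_map_incl[OF g Comp_Hom[OF k f]] Comp_assoc[OF k f g] ..
  qed
qed (rule alpha_map_Hom)

definition alpha_comp :: "'o \<Rightarrow> 'm" where
  "alpha_comp L = (THE u. u \<in> Hom C (alpha_obj C N M L) L \<and>
           (\<forall>f \<in> Hom C M L. u \<cdot>\<^bsub>C\<^esub> alpha_incl C N M L f = f \<cdot>\<^bsub>C\<^esub> h))"

lemma alpha_comp:
  assumes L: "L \<in> Obj C"
  shows alpha_comp_Hom: "alpha_comp L \<in> Hom C (alpha_obj C N M L) L"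
    and alpha_comp_incl: "f \<in> Hom C M L \<Longrightarrow> alpha_comp L \<cdot>\<^bsub>C\<^esub> alpha_incl C N M L f = f \<cdot>\<^bsub>C\<^esub> h"
proof -
  from theI'[OF coproduct_ex1[OF copr[OF L] L, of "\<lambda>f. f \<cdot>\<^bsub>C\<^esub> h", OF Comp_Hom[OF h]]]
  have "alpha_comp L \<in> Hom C (alpha_obj C N M L) L \<and>
      (\<forall>f \<in> Hom C M L. alpha_comp L \<cdot>\<^bsub>C\<^esub> alpha_incl C N M L f = f \<cdot>\<^bsub>C\<^esub> h)"
    unfolding alpha_comp_def by simp
  then show "alpha_comp L \<in> Hom C (alpha_obj C N M L) L"
    "f \<in> Hom C M L \<Longrightarrow> alpha_comp L \<cdot>\<^bsub>C\<^esub> alpha_incl C N M L f = f \<cdot>\<^bsub>C\<^esub> h"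
    by blast+
qed

lemma alpha_nattr_Hom: "alpha_nattr C h \<in> Hom (Fun C C) (alpha_fctr C N M) (id_fctr C)"
proof -
  have DC: "Dom C h = N" "Cod C h = M" using h by (auto simp: Hom_iff)
  have "is_nattr C C \<lparr>src = alpha_fctr C N M, tgt = id_fctr C, component = restrict alpha_comp (Obj C)\<rparr>"
  proof (rule FC.nattrI[OF is_functor_alpha is_functor_id_fctr])
    fix X Y f assume f: "f \<in> Hom C X Y"
    note o = Hom_Obj[OF f]
    have fm: "amap (alpha_fctr C N M) f = alpha_map f" "amap (id_fctr C) f = f"
      using f by (simp_all add: alpha_fctr_eq id_fctr_def Hom_iff)
    show "alpha_comp Y \<cdot>\<^bsub>C\<^esub> amap (alpha_fctr C N M) f = amap (id_fctr C) f \<cdot>\<^bsub>C\<^esub> alpha_comp X"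
      unfolding fm
    proof (rule alpha_eqI[OF o(1) Comp_Hom[OF alpha_map_Hom[OF f] alpha_comp_Hom[OF o(2)]]
          Comp_Hom[OF alpha_comp_Hom[OF o(1)] f]])
      fix k assume k: "k \<in> Hom C M X"
      note i = incl_Hom[OF k]
      show "(alpha_comp Y \<cdot>\<^bsub>C\<^esub> alpha_map f) \<cdot>\<^bsub>C\<^esub> alpha_incl C N M X k =
          (f \<cdot>\<^bsub>C\<^esub> alpha_comp X) \<cdot>\<^bsub>C\<^esub> alpha_incl C N M X k"
        unfolding Comp_assoc[OF i alpha_map_Hom[OF f] alpha_comp_Hom[OF o(2)]] alpha_map_incl[OF f k]
          alpha_comp_incl[OF o(2) Comp_Hom[OF k f]] Comp_assoc[OF i alpha_comp_Hom[OF o(1)] f]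
          alpha_comp_incl[OF o(1) k] by (rule Comp_assoc[OF h k f])
    qed
  qed (use alpha_comp_Hom in \<open>simp add: alpha_omap id_fctr_def\<close>)
  then show ?thesis
    unfolding alpha_nattr_def Let_def DC Hom_Fun
    by (simp add: alpha_comp_def[abs_def])
qed

lemma alpha_nattr_component: "L \<in> Obj C \<Longrightarrow> component (alpha_nattr C h) L = alpha_comp L"
  using h by (simp add: alpha_nattr_def Let_def alpha_comp_def Hom_iff)

text \<open>An arrow out of the copower vanishes iff it vanishes on every inclusion, and a_h sends
  the inclusion of index f to f h. The claim is about one object and one arrow because it is used
  for G(s_Y) in \<open>A\<close> and for s_Y in \<open>B\<close>.\<close>

lemma comp_alpha_zero_iff:
  assumes Z: "zero_object C Z" and u: "u \<in> Hom C L Y"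
  shows "zero_arrow C (u \<cdot>\<^bsub>C\<^esub> component (alpha_nattr C h) L) \<longleftrightarrow>
    (\<forall>f \<in> Hom C M L. zero_arrow C (u \<cdot>\<^bsub>C\<^esub> (f \<cdot>\<^bsub>C\<^esub> h)))"
proof -
  note L = Hom_Obj(1)[OF u]
  note a = alpha_comp_Hom[OF L]
  have "(u \<cdot>\<^bsub>C\<^esub> alpha_comp L) \<cdot>\<^bsub>C\<^esub> alpha_incl C N M L f = u \<cdot>\<^bsub>C\<^esub> (f \<cdot>\<^bsub>C\<^esub> h)" if "f \<in> Hom C M L" for f
    using Comp_assoc[OF incl_Hom[OF that] a u] alpha_comp_incl[OF L that] by simp
  then show ?thesis
    using coproduct_zero_iff[OF copr[OF L] Z Comp_Hom[OF a u]] by (simp add: alpha_nattr_component[OF L])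
qed

end

section \<open>Transposition along an adjunction\<close>

locale adjoint_pair = A: category A + B: category B
  for A :: "('oa, 'ma) cat" and B :: "('ob, 'mb) cat" +
  fixes F :: "('oa, 'ma, 'ob, 'mb) fctr" and G :: "('ob, 'mb, 'oa, 'ma) fctr"
    and \<eta> :: "('oa, 'ma, 'oa, 'ma) nattr" and \<epsilon> :: "('ob, 'mb, 'ob, 'mb) nattr"
  assumes adj: "adjunction A B F G \<eta> \<epsilon>"
begin

lemma F: "is_functor A B F" and G: "is_functor B A G"
  using adj by (auto simp: adjunction_def)

abbreviation "unit \<equiv> component \<eta>"
abbreviation "counit \<equiv> component \<epsilon>"

lemma unit_Hom: "X \<in> Obj A \<Longrightarrow> unit X \<in> Hom A X (omap G (omap F X))"
  using adj nattr_Hom[of A A \<eta> X]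
  by (auto simp: adjunction_def Hom_Fun id_fctr_def comp_fctr_def compose_def)

lemma counit_Hom: "Y \<in> Obj B \<Longrightarrow> counit Y \<in> Hom B (omap F (omap G Y)) Y"
  using adj nattr_Hom[of B B \<epsilon> Y]
  by (auto simp: adjunction_def Hom_Fun id_fctr_def comp_fctr_def compose_def)

lemma unit_natural:
  assumes "f \<in> Hom A X Y"
  shows "unit Y \<cdot>\<^bsub>A\<^esub> f = amap G (amap F f) \<cdot>\<^bsub>A\<^esub> unit X"
  using adj nattr_natural[OF _ assms, of A \<eta>] assms
  by (auto simp: adjunction_def Hom_Fun id_fctr_def comp_fctr_def compose_def Hom_iff)

lemma counit_natural:
  assumes "f \<in> Hom B X Y"
  shows "counit Y \<cdot>\<^bsub>B\<^esub> amap F (amap G f) = f \<cdot>\<^bsub>B\<^esub> counit X"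
  using adj nattr_natural[OF _ assms, of B \<epsilon>] assms
  by (auto simp: adjunction_def Hom_Fun id_fctr_def comp_fctr_def compose_def Hom_iff)

lemma triangle_F: "X \<in> Obj A \<Longrightarrow> counit (omap F X) \<cdot>\<^bsub>B\<^esub> amap F (unit X) = Idt B (omap F X)"
  using adj by (simp add: adjunction_def)

lemma triangle_G: "Y \<in> Obj B \<Longrightarrow> amap G (counit Y) \<cdot>\<^bsub>A\<^esub> unit (omap G Y) = Idt A (omap G Y)"
  using adj by (simp add: adjunction_def)

text \<open>The adjunction bijection from Hom(X, G Y) to Hom(F X, Y). The object Y is an explicit
  argument since w determines only G Y.\<close>

definition transp :: "'ob \<Rightarrow> 'ma \<Rightarrow> 'mb" where
  "transp Y w = counit Y \<cdot>\<^bsub>B\<^esub> amap F w"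

lemma transp_Hom:
  assumes "Y \<in> Obj B" "w \<in> Hom A X (omap G Y)"
  shows "transp Y w \<in> Hom B (omap F X) Y"
  unfolding transp_def using B.Comp_Hom[OF functor_Hom[OF F assms(2)] counit_Hom[OF assms(1)]] .

text \<open>Naturality of the unit moves w to its right, and the triangle identity for G removes
  what is left of w. In particular transposition is injective.\<close>

lemma transp_inverse:
  assumes Y: "Y \<in> Obj B" and w: "w \<in> Hom A X (omap G Y)"
  shows "amap G (transp Y w) \<cdot>\<^bsub>A\<^esub> unit X = w"
proof -
  note X = A.Hom_Obj(1)[OF w] and GY = A.Hom_Obj(2)[OF w]
  note Fw = functor_Hom[OF F w]
  have "amap G (transp Y w) \<cdot>\<^bsub>A\<^esub> unit X = amap G (counit Y) \<cdot>\<^bsub>A\<^esub> (amap G (amap F w) \<cdot>\<^bsub>A\<^esub> unit X)"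
    unfolding transp_def functor_Comp[OF G Fw counit_Hom[OF Y]]
    by (rule A.Comp_assoc[OF unit_Hom[OF X] functor_Hom[OF G Fw] functor_Hom[OF G counit_Hom[OF Y]]])
  also have "\<dots> = (amap G (counit Y) \<cdot>\<^bsub>A\<^esub> unit (omap G Y)) \<cdot>\<^bsub>A\<^esub> w"
    unfolding unit_natural[OF w, symmetric]
    by (rule A.Comp_assoc[OF w unit_Hom[OF GY] functor_Hom[OF G counit_Hom[OF Y]], symmetric])
  also have "\<dots> = w" unfolding triangle_G[OF Y] by (rule A.Idt_Comp[OF w])
  finally show ?thesis .
qed

lemma transp_comp:
  assumes Y: "Y \<in> Obj B" and w: "w \<in> Hom A X (omap G Y)" and v: "v \<in> Hom A W X"
  shows "transp Y (w \<cdot>\<^bsub>A\<^esub> v) = transp Y w \<cdot>\<^bsub>B\<^esub> amap F v"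
  unfolding transp_def functor_Comp[OF F v w]
  by (rule B.Comp_assoc[OF functor_Hom[OF F v] functor_Hom[OF F w] counit_Hom[OF Y], symmetric])

text \<open>Naturality of transposition in Y, from naturality of the counit. With g = s_Y it moves
  the annihilation test from \<open>B\<close> to \<open>A\<close>.\<close>

lemma transp_G_comp:
  assumes g: "g \<in> Hom B Y Y'" and w: "w \<in> Hom A X (omap G Y)"
  shows "transp Y' (amap G g \<cdot>\<^bsub>A\<^esub> w) = g \<cdot>\<^bsub>B\<^esub> transp Y w"
proof -
  note Y = B.Hom_Obj[OF g]
  have "transp Y' (amap G g \<cdot>\<^bsub>A\<^esub> w) = (g \<cdot>\<^bsub>B\<^esub> counit Y) \<cdot>\<^bsub>B\<^esub> amap F w"
    unfolding transp_comp[OF Y(2) functor_Hom[OF G g] w] unfolding transp_def counit_natural[OF g] ..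
  also have "\<dots> = g \<cdot>\<^bsub>B\<^esub> transp Y w"
    unfolding transp_def by (rule B.Comp_assoc[OF functor_Hom[OF F w] counit_Hom[OF Y(1)] g])
  finally show ?thesis .
qed

text \<open>The witness is the transpose in the other direction, G g after the unit; the triangle
  identity for F gives back g.\<close>

lemma transp_surj:
  assumes X: "X \<in> Obj A" and g: "g \<in> Hom B (omap F X) Y"
  shows "\<exists>w \<in> Hom A X (omap G Y). transp Y w = g"
proof
  note FX = functor_Obj[OF F X]
  show "transp Y (amap G g \<cdot>\<^bsub>A\<^esub> unit X) = g"
    unfolding transp_G_comp[OF g unit_Hom[OF X]] unfolding transp_def triangle_F[OF X]
    by (rule B.Comp_Idt[OF g])
  show "amap G g \<cdot>\<^bsub>A\<^esub> unit X \<in> Hom A X (omap G Y)"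
    by (rule A.Comp_Hom[OF unit_Hom[OF X] functor_Hom[OF G g]])
qed

lemma transp_inj:
  assumes "Y \<in> Obj B" "w \<in> Hom A X (omap G Y)" "w' \<in> Hom A X (omap G Y)" "transp Y w = transp Y w'"
  shows "w = w'"
  by (rule trans[OF transp_inverse[OF assms(1,2), symmetric]])
    (unfold assms(4), rule transp_inverse[OF assms(1,3)])

text \<open>The set \<open>Hom(F 0, F 0)\<close> is in bijection with \<open>Hom(0, G F 0)\<close>, so the identity of \<open>F 0\<close> is a
  zero arrow; dually for \<open>G\<close>.\<close>

lemma F_zero:
  assumes ZB: "zero_object B ZB" and w: "w \<in> Hom A X Y" and z: "zero_arrow A w"
  shows "zero_arrow B (amap F w)"
proof -
  obtain Z u v where Z: "zero_object A Z" and uv: "u \<in> Hom A X Z" "v \<in> Hom A Z Y" "w = v \<cdot>\<^bsub>A\<^esub> u"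
    using A.zero_arrowE[OF z w] by metis
  have ZO: "Z \<in> Obj A" using Z by (simp add: zero_object_def)
  note FZ = functor_Obj[OF F ZO]
  obtain k where k: "k \<in> Hom B (omap F Z) (omap F Z)" "zero_arrow B k"
    using B.ex_zero_arrow[OF ZB FZ FZ] by blast
  obtain p q where p: "p \<in> Hom A Z (omap G (omap F Z))" "transp (omap F Z) p = k"
    and q: "q \<in> Hom A Z (omap G (omap F Z))" "transp (omap F Z) q = Idt B (omap F Z)"
    using transp_surj[OF ZO k(1)] transp_surj[OF ZO B.Idt_Hom[OF FZ]] by blast
  have "p = q" using A.zero_object_ex1(2)[OF Z functor_Obj[OF G FZ]] p(1) q(1) by blast
  then have "zero_arrow B (Idt B (omap F Z))" using p q k by simp
  from B.zero_arrow_comp_right[OF this B.Idt_Hom[OF FZ] functor_Hom[OF F uv(1)]]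
  have "zero_arrow B (amap F u)" unfolding B.Idt_Comp[OF functor_Hom[OF F uv(1)]] .
  from B.zero_arrow_comp_left[OF this functor_Hom[OF F uv(1)] functor_Hom[OF F uv(2)]]
  show ?thesis using functor_Comp[OF F uv(1,2)] uv(3) by simp
qed

lemma G_zero:
  assumes ZA: "zero_object A ZA" and w: "w \<in> Hom B X Y" and z: "zero_arrow B w"
  shows "zero_arrow A (amap G w)"
proof -
  obtain Z u v where Z: "zero_object B Z" and uv: "u \<in> Hom B X Z" "v \<in> Hom B Z Y" "w = v \<cdot>\<^bsub>B\<^esub> u"
    using B.zero_arrowE[OF z w] by metis
  have ZO: "Z \<in> Obj B" using Z by (simp add: zero_object_def)
  note GZ = functor_Obj[OF G ZO]
  obtain k where k: "k \<in> Hom A (omap G Z) (omap G Z)" "zero_arrow A k"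
    using A.ex_zero_arrow[OF ZA GZ GZ] by blast
  \<comment> \<open>Both transposes end in the zero object Z of \<open>B\<close>, so they agree; by
    injectivity the identity of G Z equals the zero endomorphism k.\<close>
  have "transp Z k = transp Z (Idt A (omap G Z))"
    using B.zero_object_ex1(1)[OF Z functor_Obj[OF F GZ]]
      transp_Hom[OF ZO k(1)] transp_Hom[OF ZO A.Idt_Hom[OF GZ]] by blast
  from transp_inj[OF ZO k(1) A.Idt_Hom[OF GZ] this]
  have "zero_arrow A (Idt A (omap G Z))" using k by simp
  from A.zero_arrow_comp_right[OF this A.Idt_Hom[OF GZ] functor_Hom[OF G uv(1)]]
  have "zero_arrow A (amap G u)" unfolding A.Idt_Comp[OF functor_Hom[OF G uv(1)]] .
  from A.zero_arrow_comp_left[OF this functor_Hom[OF G uv(1)] functor_Hom[OF G uv(2)]]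
  show ?thesis using functor_Comp[OF G uv(1,2)] uv(3) by simp
qed

text \<open>From left to right, G preserves zero arrows and \<open>transp_inverse\<close> recovers
  w; from right to left, F preserves them.\<close>

lemma transp_zero_iff:
  assumes ZA: "zero_object A ZA" and ZB: "zero_object B ZB"
    and Y: "Y \<in> Obj B" and w: "w \<in> Hom A X (omap G Y)"
  shows "zero_arrow B (transp Y w) \<longleftrightarrow> zero_arrow A w"
proof
  assume "zero_arrow B (transp Y w)"
  note tH = transp_Hom[OF Y w]
  from A.zero_arrow_comp_right[OF G_zero[OF ZA tH \<open>zero_arrow B (transp Y w)\<close>] functor_Hom[OF G tH]
      unit_Hom[OF A.Hom_Obj(1)[OF w]]]
  show "zero_arrow A w" unfolding transp_inverse[OF Y w] .
next
  assume "zero_arrow A w"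
  then show "zero_arrow B (transp Y w)"
    unfolding transp_def
    by (rule B.zero_arrow_comp_left[OF F_zero[OF ZB w] functor_Hom[OF F w] counit_Hom[OF Y]])
qed

end


section \<open>Composite functors, whiskering and composition with the counit\<close>

lemma (in functor_category) comp_fctr_id_left:
  assumes K: "is_functor C D K" shows "comp_fctr C (id_fctr D) K = K"
proof -
  have e: "omap K \<in> extensional (Obj C)" "amap K \<in> extensional (Arr C)"
    using K unfolding is_functor_def PiE_def by blast+
  have "compose (Obj C) (omap (id_fctr D)) (omap K) = omap K"
    by (rule extensionalityI[OF compose_extensional e(1)])
      (simp add: compose_def id_fctr_def functor_Obj[OF K])
  moreover have "compose (Arr C) (amap (id_fctr D)) (amap K) = amap K"
  proof (rule extensionalityI[OF compose_extensional e(2)])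
    fix f assume f: "f \<in> Arr C"
    then have "amap K f \<in> Arr D" using functor_Hom[OF K C.Arr_Hom[OF f]] by (simp add: Hom_iff)
    then show "compose (Arr C) (amap (id_fctr D)) (amap K) f = amap K f"
      using f by (simp add: compose_def id_fctr_def)
  qed
  ultimately show ?thesis by (simp add: comp_fctr_def)
qed

lemma is_functor_comp_fctr:
  assumes "category C" "category D" "category E" "is_functor C D F" "is_functor D E G"
  shows "is_functor C E (comp_fctr C G F)"
proof -
  interpret C: category C by fact
  interpret D: category D by fact
  interpret E: category E by fact
  interpret functor_category C E ..
  have "is_functor C E \<lparr>omap = restrict (\<lambda>X. omap G (omap F X)) (Obj C),
      amap = restrict (\<lambda>f. amap G (amap F f)) (Arr C)\<rparr>"
  proof (rule functorI)
    show "amap G (amap F (g \<cdot>\<^bsub>C\<^esub> f)) = amap G (amap F g) \<cdot>\<^bsub>E\<^esub> amap G (amap F f)"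
      if "f \<in> Hom C X Y" "g \<in> Hom C Y Z" for X Y Z f g
      unfolding functor_Comp[OF assms(4) that]
      by (rule functor_Comp[OF assms(5) that[THEN functor_Hom[OF assms(4)]]])
  qed (simp_all add: functor_Obj[OF assms(5)] functor_Obj[OF assms(4)] functor_Idt[OF assms(4)]
      functor_Idt[OF assms(5)] functor_Hom[OF assms(5) functor_Hom[OF assms(4)]])
  then show ?thesis by (simp add: comp_fctr_def compose_def)
qed

context adjoint_pair
begin

lemma counit_whisker_Hom:
  assumes t: "\<tau> \<in> Hom (Fun A A) T (id_fctr A)"
  shows "\<epsilon> \<cdot>\<^bsub>Fun B B\<^esub> whisker B F \<tau> G \<in>
    Hom (Fun B B) (comp_fctr B F (comp_fctr B T G)) (id_fctr B)"
proof -
  interpret AA: functor_category A A ..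
  interpret BA: functor_category B A ..
  interpret BB: functor_category B B ..
  have T: "is_functor A A T" using t by (auto simp: Hom_Fun is_nattr_def)
  have TG: "is_functor B A (comp_fctr B T G)"
    by (rule is_functor_comp_fctr[OF B.category_axioms A.category_axioms A.category_axioms G T])
  have FTG: "is_functor B B (comp_fctr B F (comp_fctr B T G))"
    by (rule is_functor_comp_fctr[OF B.category_axioms A.category_axioms B.category_axioms TG F])
  have FG: "is_functor B B (comp_fctr B F G)"
    by (rule is_functor_comp_fctr[OF B.category_axioms A.category_axioms B.category_axioms G F])
  have st: "src \<tau> = T" "tgt \<tau> = id_fctr A" using t by (auto simp: Hom_Fun)
  have tH: "component \<tau> (omap G Y) \<in> Hom A (omap T (omap G Y)) (omap G Y)" if "Y \<in> Obj B" for Y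
    using AA.Hom_Fun_component[OF t functor_Obj[OF G that]] functor_Obj[OF G that]
    by (simp add: id_fctr_def)
  have "is_nattr B B \<lparr>src = comp_fctr B F (comp_fctr B T G), tgt = comp_fctr B F G,
      component = (\<lambda>Y \<in> Obj B. amap F (component \<tau> (omap G Y)))\<rparr>"
  proof (rule BB.nattrI[OF FTG FG])
    show "amap F (component \<tau> (omap G Y)) \<in>
        Hom B (omap (comp_fctr B F (comp_fctr B T G)) Y) (omap (comp_fctr B F G) Y)"
      if "Y \<in> Obj B" for Y
      using functor_Hom[OF F tH[OF that]] that by (simp add: comp_fctr_def compose_def)
    fix X Y f assume f: "f \<in> Hom B X Y"
    note XY = B.Hom_Obj[OF f]
    note Gf = functor_Hom[OF G f]
    have fm: "amap (comp_fctr B F (comp_fctr B T G)) f = amap F (amap T (amap G f))"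
      "amap (comp_fctr B F G) f = amap F (amap G f)"
      using f by (simp_all add: comp_fctr_def compose_def Hom_iff)
    have nt: "component \<tau> (omap G Y) \<cdot>\<^bsub>A\<^esub> amap T (amap G f) = amap G f \<cdot>\<^bsub>A\<^esub> component \<tau> (omap G X)"
      using nattr_natural[OF _ Gf, of A \<tau>] t Gf by (simp add: Hom_Fun id_fctr_def Hom_iff[of "amap G f"])
    show "amap F (component \<tau> (omap G Y)) \<cdot>\<^bsub>B\<^esub> amap (comp_fctr B F (comp_fctr B T G)) f =
        amap (comp_fctr B F G) f \<cdot>\<^bsub>B\<^esub> amap F (component \<tau> (omap G X))"
      unfolding fm functor_Comp[OF F functor_Hom[OF T Gf] tH[OF XY(2)], symmetric]
        functor_Comp[OF F tH[OF XY(1)] Gf, symmetric] nt ..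
  qed
  \<comment> \<open>The target of the whiskered transformation is F (1 G). By
    \<open>comp_fctr_id_left\<close> it equals F G as a record, and F G is the source of
    \<epsilon>.\<close>
  then have "whisker B F \<tau> G \<in> Hom (Fun B B) (comp_fctr B F (comp_fctr B T G)) (comp_fctr B F G)"
    by (simp add: Hom_Fun whisker_def st BA.comp_fctr_id_left[OF G])
  then show ?thesis using adj by (intro BB.Fun_Comp_Hom) (auto simp: adjunction_def)
qed

end

text \<open>Since a factors through its image k, whatever annihilates k at X annihilates a.
  Conversely, if x annihilates a at X, then x factors through the component of q at X, and q k = 0.
  It is essential that this component is itself a cokernel, because x lives at one object and need
  not extend to a natural transformation.\<close>

lemma kernel_of_cokernel_Fun_annihilators:
  assumes C: "category C" and D: "category D" and Z: "zero_object D Z"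
    and a: "a \<in> Hom (Fun C D) S R"
    and q: "is_cokernel (Fun C D) a q"
    and qX: "\<And>X. X \<in> Obj C \<Longrightarrow> is_cokernel D (component a X) (component q X)"
    and k: "is_kernel (Fun C D) q k"
    and X: "X \<in> Obj C" and x: "x \<in> Hom D (omap R X) Y"
  shows "zero_arrow D (x \<cdot>\<^bsub>D\<^esub> component k X) \<longleftrightarrow> zero_arrow D (x \<cdot>\<^bsub>D\<^esub> component a X)"
proof -
  interpret C: category C by fact
  interpret D: category D by fact
  interpret functor_category C D ..
  have qH: "q \<in> Hom (Fun C D) R (tgt q)"
    using Fun.cokernel_Hom[OF q] a by (simp add: Hom_Fun)
  have kH: "k \<in> Hom (Fun C D) (src k) R"
    using Fun.kernel_Hom[OF k] qH by (simp add: Hom_Fun)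
  note aX = Hom_Fun_component[OF a X] and kX = Hom_Fun_component[OF kH X] and
    qXH = Hom_Fun_component[OF qH X]
  have "a \<in> Hom (Fun C D) S (Dom (Fun C D) q)" using a qH by (simp add: Hom_Fun)
  from Fun.kernel_factor[OF k this Fun.cokernel_zero[OF q]]
  obtain e where e: "e \<in> Hom (Fun C D) S (src k)" "k \<cdot>\<^bsub>Fun C D\<^esub> e = a" by auto
  note eX = Hom_Fun_component[OF e(1) X]
  show ?thesis
  proof
    assume "zero_arrow D (x \<cdot>\<^bsub>D\<^esub> component k X)"
    from D.zero_arrow_comp_right[OF this D.Comp_Hom[OF kX x] eX]
    show "zero_arrow D (x \<cdot>\<^bsub>D\<^esub> component a X)"
      unfolding D.Comp_assoc[OF eX kX x] using e(2) X by (metis Fun_Comp_component)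
  next
    assume "zero_arrow D (x \<cdot>\<^bsub>D\<^esub> component a X)"
    moreover have "x \<in> Hom D (Cod D (component a X)) Y" using x aX by (simp add: Hom_iff)
    ultimately obtain y where y: "y \<in> Hom D (Cod D (component q X)) Y" "y \<cdot>\<^bsub>D\<^esub> component q X = x"
      using D.cokernel_factor[OF qX[OF X]] by blast
    have yH: "y \<in> Hom D (omap (tgt q) X) Y" using y(1) qXH by (simp add: Hom_iff)
    have "zero_arrow (Fun C D) (q \<cdot>\<^bsub>Fun C D\<^esub> k)" using Fun.kernel_zero[OF k] .
    then have "zero_arrow D (component q X \<cdot>\<^bsub>D\<^esub> component k X)"
      unfolding zero_arrow_Fun_iff[OF Z Fun_Comp_Hom[OF kH qH]] using X by simp
    from D.zero_arrow_comp_left[OF this D.Comp_Hom[OF kX qXH] yH]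
    show "zero_arrow D (x \<cdot>\<^bsub>D\<^esub> component k X)"
      unfolding D.Comp_assoc[OF kX qXH yH, symmetric] y(2) .
  qed
qed

theorem proposition6p6:
  fixes U :: "'u set"
    and A :: "('oa, 'ma) cat"
    and B :: "('ob, 'mb) cat"
    and F :: "('oa, 'ma, 'ob, 'mb) fctr"
    and G :: "('ob, 'mb, 'oa, 'ma) fctr"
    and \<eta> :: "('oa, 'ma, 'oa, 'ma) nattr"
    and \<epsilon> :: "('ob, 'mb, 'ob, 'mb) nattr"
  assumes "abelian_category A" and "locally_small U A" and "bicomplete U A"
    and "abelian_category B" and "locally_small U B" and "bicomplete U B"
    and "adjunction A B F G \<eta> \<epsilon>"
    and "(\<phi>, \<psi>) = induced_galois_connection A B F G \<eta> \<epsilon>"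
    and "N \<in> Obj A" and "M \<in> Obj A" and "h \<in> Hom A N M"
  shows "\<phi> (alpha_preradical A h) = alpha_preradical B (amap F h)"
proof -
  interpret A: abelian_category A by fact
  interpret B: abelian_category B by fact
  interpret adjoint_pair A B F G \<eta> \<epsilon> by unfold_locales fact
  interpret AA: functor_category A A ..
  interpret BB: functor_category B B ..
  note h = \<open>h \<in> Hom A N M\<close>
  note Fh = functor_Hom[OF F h]
  \<comment> \<open>Local smallness makes Hom(M, L) a small index set, so bicompleteness supplies
    the copowers; the same happens next in \<open>B\<close>.\<close>
  interpret aA: alpha A N M h
  proof unfold_locales
    fix L assume L: "L \<in> Obj A"
    then have "small U (Hom A M L)" using assms(2,10) by (simp add: locally_small_def)
    then show "\<exists>Q q. is_coproduct A (Hom A M L) (\<lambda>_. N) Q q"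
      by (rule ex_coproduct[OF A.category_axioms assms(3)]) (rule assms(9))
  qed (rule h)
  interpret aB: alpha B "omap F N" "omap F M" "amap F h"
  proof unfold_locales
    fix L assume L: "L \<in> Obj B"
    then have "small U (Hom B (omap F M) L)"
      using assms(5) functor_Obj[OF F assms(10)] by (simp add: locally_small_def)
    then show "\<exists>Q q. is_coproduct B (Hom B (omap F M) L) (\<lambda>_. omap F N) Q q"
      by (rule ex_coproduct[OF B.category_axioms assms(6)]) (rule functor_Obj[OF F assms(9)])
  qed (rule Fh)
  obtain ZA ZB where ZA: "zero_object A ZA" and ZB: "zero_object B ZB"
    using A.ex_zero B.ex_zero by blast
  define a where "a = alpha_nattr A h"
  have a: "a \<in> Hom (Fun A A) (alpha_fctr A N M) (id_fctr A)"
    unfolding a_def by (rule aA.alpha_nattr_Hom)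
  have ck: "\<exists>q. is_cokernel A (component a X) q" if "X \<in> Obj A" for X
    using A.ex_cokernel AA.Hom_Fun_component[OF a that] by (auto simp: Hom_iff)
  obtain q where q: "is_cokernel (Fun A A) a q"
    and qX: "\<And>X. X \<in> Obj A \<Longrightarrow> is_cokernel A (component a X) (component q X)"
    using AA.ex_pointwise_cokernel[OF ZA a ck] by blast
  have qH: "q \<in> Hom (Fun A A) (id_fctr A) (tgt q)"
    using AA.Fun.cokernel_Hom[OF q] a by (simp add: Hom_Fun)
  have "\<exists>k. is_kernel A (component q X) k" if "X \<in> Obj A" for X
    using A.ex_kernel AA.Hom_Fun_component[OF qH that] by (auto simp: Hom_iff)
  then obtain k where k: "is_kernel (Fun A A) q k" using AA.ex_Fun_kernel[OF ZA qH] by blast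
  define P where "P = alpha_preradical A h"
  \<comment> \<open>All representatives of \<alpha>_h are kernels of one fixed q, so a single
    pointwise cokernel handles every one of them.\<close>
  have P: "P = {k. is_kernel (Fun A A) q k}"
    unfolding P_def alpha_preradical_def using AA.Fun.image_subobject_eq_kernels[OF q] a_def by simp
  have "monic (Fun A A) k" using AA.Fun.kernel_monic[OF k] .
  moreover have "Cod (Fun A A) k = id_fctr A"
    using AA.Fun.kernel_Hom[OF k] qH by (simp add: Hom_Fun)
  moreover have "P = subobject_class (Fun A A) k"
    unfolding P using AA.Fun.kernel_iff_subobject_class[OF k] by blast
  \<comment> \<open>The function \<open>induced_phi\<close> is restricted to \<open>Pr A\<close>;
    this membership is what allows its defining formula to be used at \<alpha>_h.\<close>
  ultimately have PPr: "P \<in> Pr A" unfolding Pr_def subobjects_def by blast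
  \<comment> \<open>Independence of the representative comes out of the argument itself: \<tau> is
    an arbitrary kernel of q, and the resulting set does not mention it.\<close>
  have im: "image_subobject (Fun B B) (\<epsilon> \<cdot>\<^bsub>Fun B B\<^esub> whisker B F \<tau> G) = alpha_preradical B (amap F h)"
    if "\<tau> \<in> P" for \<tau>
  proof -
    have tk: "is_kernel (Fun A A) q \<tau>" using that P by simp
    have t: "\<tau> \<in> Hom (Fun A A) (src \<tau>) (id_fctr A)"
      using AA.Fun.kernel_Hom[OF tk] qH by (simp add: Hom_Fun)
    note wH = counit_whisker_Hom[OF t]
    note bH = aB.alpha_nattr_Hom
    show ?thesis
      unfolding alpha_preradical_def
    proof (rule BB.Fun.image_subobject_cong)
      fix K s assume "s \<in> Hom (Fun B B) (Cod (Fun B B) (\<epsilon> \<cdot>\<^bsub>Fun B B\<^esub> whisker B F \<tau> G)) K"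
      then have s: "s \<in> Hom (Fun B B) (id_fctr B) K" using wH by (simp add: Hom_Fun)
      \<comment> \<open>The left side is the component at Y of s \<epsilon> F\<tau>G: its factor
        \<epsilon>_Y F(\<tau>_{GY}) is by definition the transpose of \<tau>_{GY}.\<close>
      have "zero_arrow B (component s Y \<cdot>\<^bsub>B\<^esub> transp Y (component \<tau> (omap G Y))) \<longleftrightarrow>
          zero_arrow B (component s Y \<cdot>\<^bsub>B\<^esub> component (alpha_nattr B (amap F h)) Y)"
        if Y: "Y \<in> Obj B" for Y
      proof -
        have sY: "component s Y \<in> Hom B Y (omap K Y)"
          using BB.Hom_Fun_component[OF s Y] Y by (simp add: id_fctr_def)
        note KY = B.Hom_Obj(2)[OF sY] and GY = functor_Obj[OF G Y] and GsY = functor_Hom[OF G sY]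
        have tY: "component \<tau> (omap G Y) \<in> Hom A (omap (src \<tau>) (omap G Y)) (omap G Y)"
          using AA.Hom_Fun_component[OF t GY] GY by (simp add: id_fctr_def)
        \<comment> \<open>The same arrow, with its domain written as the value of the identity
          functor at GY; this is the R of
          \<open>kernel_of_cokernel_Fun_annihilators\<close>.\<close>
        have GsY': "amap G (component s Y) \<in> Hom A (omap (id_fctr A) (omap G Y)) (omap G (omap K Y))"
          using GsY GY by (simp add: id_fctr_def)
        have tr: "zero_arrow B (component s Y \<cdot>\<^bsub>B\<^esub> transp Y w) \<longleftrightarrow>
            zero_arrow A (amap G (component s Y) \<cdot>\<^bsub>A\<^esub> w)" if "w \<in> Hom A X (omap G Y)" for w X
          using transp_zero_iff[OF ZA ZB KY A.Comp_Hom[OF that GsY]] transp_G_comp[OF sY that] by simp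
        have "zero_arrow B (component s Y \<cdot>\<^bsub>B\<^esub> transp Y (component \<tau> (omap G Y))) \<longleftrightarrow>
            zero_arrow A (amap G (component s Y) \<cdot>\<^bsub>A\<^esub> component a (omap G Y))"
          unfolding tr[OF tY]
          by (rule kernel_of_cokernel_Fun_annihilators[OF A.category_axioms A.category_axioms
                ZA a q qX tk GY GsY'])
        also have "\<dots> \<longleftrightarrow> (\<forall>f \<in> Hom A M (omap G Y).
            zero_arrow A (amap G (component s Y) \<cdot>\<^bsub>A\<^esub> (f \<cdot>\<^bsub>A\<^esub> h)))"
          unfolding a_def by (rule aA.comp_alpha_zero_iff[OF ZA GsY])
        also have "\<dots> \<longleftrightarrow> (\<forall>f \<in> Hom A M (omap G Y).
            zero_arrow B (component s Y \<cdot>\<^bsub>B\<^esub> (transp Y f \<cdot>\<^bsub>B\<^esub> amap F h)))"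
          by (intro ball_cong refl)
            (simp add: tr[OF A.Comp_Hom[OF h], symmetric] transp_comp[OF Y _ h])
        \<comment> \<open>Since transposition is onto, the transposes of the arrows f from M to GY
          are all the arrows g from FM to Y.\<close>
        also have "\<dots> \<longleftrightarrow> (\<forall>g \<in> Hom B (omap F M) Y.
            zero_arrow B (component s Y \<cdot>\<^bsub>B\<^esub> (g \<cdot>\<^bsub>B\<^esub> amap F h)))"
          using transp_surj[OF \<open>M \<in> Obj A\<close>] transp_Hom[OF Y] by metis
        also have "\<dots> \<longleftrightarrow> zero_arrow B (component s Y \<cdot>\<^bsub>B\<^esub> component (alpha_nattr B (amap F h)) Y)"
          by (rule aB.comp_alpha_zero_iff[OF ZB sY, symmetric])
        finally show ?thesis .
      qed
      then show "zero_arrow (Fun B B) (s \<cdot>\<^bsub>Fun B B\<^esub> (\<epsilon> \<cdot>\<^bsub>Fun B B\<^esub> whisker B F \<tau> G)) \<longleftrightarrow>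
          zero_arrow (Fun B B) (s \<cdot>\<^bsub>Fun B B\<^esub> alpha_nattr B (amap F h))"
        unfolding BB.zero_arrow_Fun_iff[OF ZB BB.Fun_Comp_Hom[OF wH s]]
          BB.zero_arrow_Fun_iff[OF ZB BB.Fun_Comp_Hom[OF bH s]]
        by (simp add: whisker_def transp_def)
    qed (use wH bH in \<open>simp_all add: Hom_Fun\<close>)
  qed
  have "\<phi> P = (\<Union>\<tau> \<in> P. image_subobject (Fun B B) (\<epsilon> \<cdot>\<^bsub>Fun B B\<^esub> whisker B F \<tau> G))"
    using assms(8) PPr by (simp add: induced_galois_connection_def induced_phi_def)
  also have "\<dots> = (\<Union>\<tau> \<in> P. alpha_preradical B (amap F h))"
    using im by (intro SUP_cong refl)
  \<comment> \<open>The union of a constant family is its common value because the index set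
    \<open>P\<close> contains k.\<close>
  also have "\<dots> = alpha_preradical B (amap F h)" using P k by auto
  finally show ?thesis unfolding P_def .
qed

end
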